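(* Let $J_t(a,c)=\lim_{\Delta a\to0^+}\frac{\mathcal{K}_{a+\Delta a,c}-\mathcal{K}_{a,c}}{\Delta a}$, where $\mathcal{K}_{a,c}$ are the integral operators defined in the context. Then $$J_t(a,c)=J_t(0,cq^{-a})\,\mathcal{K}_{a,c}.$$
   Context: Throughout $0<q<1$, $(A;q)_\infty=\prod_{k\ge0}(1-Aq^k)$, $(A_1,\dots,A_m;q)_\infty=\prod_j(A_j;q)_\infty$, and $h(\cos\theta;a_1,\dots,a_n)=\prod_{j=1}^n(a_je^{i\theta},a_je^{-i\theta};q)_\infty$. The normalized continuous $q$-Hermite weight is $w_H(x|q)=\frac{(q,e^{2i\theta},e^{-2i\theta};q)_\infty}{2\pi\sqrt{1-x^2}}$, $x=\cos\theta$. For $a>0$ and a parameter $c$, $$(\mathcal{K}_{a,c}f)(\cos\theta)=q^{a(a-3)/4}\Big(\frac{1-q}{2c}\Big)^a h(\cos\theta;-cq^{1-a/2},-q^{a/2}/c)\int_0^\pi\frac{w_H(\cos\phi|q)\,(q^a;q)_\infty\, f(\cos\phi)\sin\phi\,d\phi}{h(\cos\phi;q^{a/2}e^{i\theta},q^{a/2}e^{-i\theta})\,h(\cos\phi;-1/c,-cq)},$$ and $\mathcal{K}_{0,c}=I$ is the identity operator, so that $J_t(0,c)=\lim_{\Delta a\to0^+}(\mathcal{K}_{\Delta a,c}-I)/\Delta a$.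
   Formalization: The printed parameter cq^{-a} is corrected to cq^{-a/2}: with the given K_{a,c} the printed identity fails unless a is an even integer (e.g. a=1, generic c>0). Limits are pointwise in x, for a>0 and all f whose defining integral converges absolutely. *)

theory Defs
  imports "HOL-Analysis.Analysis"
begin

definition qpoch :: "complex \<Rightarrow> real \<Rightarrow> complex" where
  "qpoch A q = (\<Prod>k. 1 - A * of_real q ^ k)"

definition qpochs :: "complex list \<Rightarrow> real \<Rightarrow> complex" where
  "qpochs As q = (\<Prod>A\<leftarrow>As. qpoch A q)"

text \<open>Functions of \<open>x = cos \<theta>\<close>, \<open>0 \<le> \<theta> \<le> \<pi>\<close>, are written as functions of \<open>x \<in> [-1, 1]\<close> with
  \<open>\<theta> = arccos x\<close>; their values outside this interval are irrelevant.\<close>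

definition eit :: "real \<Rightarrow> complex" where
  "eit x = exp (\<i> * of_real (arccos x))"

definition h :: "real \<Rightarrow> real \<Rightarrow> complex list \<Rightarrow> complex" where
  "h q x as = (\<Prod>a\<leftarrow>as. qpochs [a * eit x, a / eit x] q)"

definition w_H :: "real \<Rightarrow> real \<Rightarrow> complex" where
  "w_H q x = qpochs [of_real q, eit x ^ 2, 1 / eit x ^ 2] q / of_real (2 * pi * sqrt (1 - x\<^sup>2))"

text \<open>The power \<open>((1 - q) / (2 c)) ^ a\<close> is the principal one; for \<open>c > 0\<close> it is the real power.\<close>

definition K :: "real \<Rightarrow> real \<Rightarrow> complex \<Rightarrow> (real \<Rightarrow> complex) \<Rightarrow> real \<Rightarrow> complex" where
  "K q a c f x =
    (if a = 0 then f x
     else of_real (q powr (a * (a - 3) / 4)) * (of_real (1 - q) / (2 * c)) powr of_real a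
        * h q x [- c * of_real (q powr (1 - a / 2)), - of_real (q powr (a / 2)) / c]
        * (LINT \<phi>:{0..pi}|lborel.
             w_H q (cos \<phi>) * qpoch (of_real (q powr a)) q * f (cos \<phi>) * of_real (sin \<phi>)
             / (h q (cos \<phi>) [of_real (q powr (a / 2)) * eit x, of_real (q powr (a / 2)) / eit x]
                * h q (cos \<phi>) [- 1 / c, - c * of_real q])))"

text \<open>The functions for which the integral defining \<open>K q a c f\<close> converges absolutely. The
  remaining factor of the integrand, \<open>1 / h(cos \<phi>; q\<^bsup>a/2\<^esup> e\<^bsup>i\<theta>\<^esup>, q\<^bsup>a/2\<^esup> e\<^bsup>-i\<theta>\<^esup>)\<close>, is continuous and
  bounded away from \<open>0\<close> and \<open>\<infinity>\<close> for \<open>a > 0\<close>, so the domain depends neither on \<open>a\<close> nor on \<open>\<theta>\<close>.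
  If \<open>c\<close> is real and nonzero, it contains all bounded measurable \<open>f\<close>, since the zeros of the
  denominator, if any, are cancelled by those of \<open>w_H\<close>.\<close>

definition K_dom :: "real \<Rightarrow> complex \<Rightarrow> (real \<Rightarrow> complex) set" where
  "K_dom q c = {f. set_integrable lborel {0..pi}
     (\<lambda>\<phi>. w_H q (cos \<phi>) * f (cos \<phi>) * of_real (sin \<phi>) / h q (cos \<phi>) [- 1 / c, - c * of_real q])}"

text \<open>Limits of operators are taken pointwise: \<open>J_t q a c\<close> sends \<open>f\<close> to the pointwise limit of the
  quotients applied to \<open>f\<close>. \<open>J_t_exists\<close> says that this limit exists at \<open>x\<close>; otherwise the value
  of \<open>J_t\<close> has no meaning.\<close>

definition J_quot :: "real \<Rightarrow> real \<Rightarrow> complex \<Rightarrow> (real \<Rightarrow> complex) \<Rightarrow> real \<Rightarrow> real \<Rightarrow> complex" where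
  "J_quot q a c f x \<delta> = (K q (a + \<delta>) c f x - K q a c f x) / of_real \<delta>"

definition J_t :: "real \<Rightarrow> real \<Rightarrow> complex \<Rightarrow> (real \<Rightarrow> complex) \<Rightarrow> real \<Rightarrow> complex" where
  "J_t q a c f x = Lim (at_right 0) (J_quot q a c f x)"

definition J_t_exists :: "real \<Rightarrow> real \<Rightarrow> complex \<Rightarrow> (real \<Rightarrow> complex) \<Rightarrow> real \<Rightarrow> bool" where
  "J_t_exists q a c f x \<longleftrightarrow> (\<exists>L. (J_quot q a c f x \<longlongrightarrow> L) (at_right 0))"

text \<open>The operators compose as \<open>K q b (c q\<^bsup>-a/2\<^esup>) \<circ> K q a c = K q (a + b) c\<close>: the kernel of the second
  operator is divided by \<open>h(cos \<phi>; -1/c', -c' q)\<close>, which must cancel the factor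
  \<open>h(cos \<phi>; -c q\<^bsup>1-a/2\<^esup>, -q\<^bsup>a/2\<^esup>/c)\<close> of the first, so \<open>c' = c q\<^bsup>-a/2\<^esup>\<close>. Hence
  \<open>J_t(a, c) = J_t(0, c q\<^bsup>-a/2\<^esup>) K\<^sub>a\<^sub>,\<^sub>c\<close>. The source prints \<open>c q\<^bsup>-a\<^esup>\<close> instead of \<open>c q\<^bsup>-a/2\<^esup>\<close>; with the
  above normalization of \<open>K\<close> that identity is false for general \<open>a\<close>.\<close>

end

theory Submission
  imports Defs
begin

text \<open>With \<open>r = q\<^bsup>a/2\<^esup>\<close>, the factor \<open>(q\<^sup>a; q)\<^sub>\<infinity> / h(cos \<phi>; r e\<^bsup>i\<theta>\<^esup>, r e\<^bsup>-i\<theta>\<^esup>)\<close> of the kernel is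
  the Poisson kernel \<open>\<Sum>\<^sub>n H\<^sub>n(cos \<theta>) H\<^sub>n(cos \<phi>) r\<^sup>n / (q; q)\<^sub>n\<close> of the continuous q-Hermite polynomials:
  both sides satisfy the same q-difference equation in \<open>r\<close>. Hence \<open>K\<^bsub>a,c\<^esub> f(cos \<theta>)\<close> is an elementary factor
  times a power series in \<open>q\<^bsup>a/2\<^esup>\<close> whose coefficients are the q-Hermite coefficients of the
  integrand. This gives differentiability in \<open>a\<close>. By orthogonality of the \<open>H\<^sub>n\<close>, applying a second operator
  multiplies the coefficients by powers of \<open>q\<^bsup>b/2\<^esup>\<close>, so that \<open>K\<^bsub>b,c'\<^esub> K\<^bsub>a,c\<^esub> = K\<^bsub>a+b,c\<^esub>\<close> for
  \<open>c' = c q\<^bsup>-a/2\<^esup>\<close>, and the difference quotients on the two sides of the claim coincide.\<close>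

section \<open>The q-Pochhammer symbol\<close>

text \<open>The derivative at a = 0 is the obstacle: there r = q^(a/2) equals 1, on the boundary of
  the disc where the series in r is controlled. It is therefore obtained only on the range of
  \<open>K q a c\<close>: for positive increments the composition law turns the quotient at 0 into
  the quotient at a > 0, where |r| < 1, and existence of the limit is carried over. The function f
  is only assumed to be in \<open>K_dom\<close>, so its weighted integrand is merely in L1. Every
  exchange of sum and integral thus rests on bounds uniform in the angle: \<open>qherm n\<close>
  grows at most linearly on the unit circle, against a geometric factor. The parameter c is any
  nonzero complex number, so the \<open>h\<close> factors may vanish at some angles. They do so only
  on a null set, and the two integrands in the composition are compared almost everywhere. A
  solution of the q-difference equation is pinned down by iterating r -> q r and using continuity at
  0. Orthogonality starts from the moments of the weight, taken from a finite form of the Jacobi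
  triple product, and the three-term recurrence spreads it to all pairs of degrees.\<close>

locale q_base =
  fixes q :: real
  assumes q_pos: "0 < q" and q_less_1: "q < 1"
begin

definition Q :: complex where "Q = of_real q"

lemma Q_norm: "norm Q = q" and Q_norm_less_1: "norm Q < 1" and Q_nonzero: "Q \<noteq> 0"
  using q_pos q_less_1 by (auto simp: Q_def)

lemma Q_power_neq_1: "n > 0 \<Longrightarrow> Q ^ n \<noteq> 1"
  using Q_norm_less_1 power_Suc_less_one[of "norm Q" "n - 1"]
  by (metis norm_ge_zero norm_one norm_power power_strict_mono power_one less_irrefl)

lemma one_minus_Q_power_nonzero: "1 - Q ^ Suc n \<noteq> 0"
  using Q_power_neq_1[of "Suc n"] by simp

lemma summable_qpoch: "summable (\<lambda>k. norm (A * Q ^ k))"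
  by (simp add: norm_mult norm_power summable_mult summable_geometric Q_norm_less_1)

lemma convergent_prod_qpoch: "convergent_prod (\<lambda>k. 1 - A * Q ^ k)"
proof -
  have "abs_convergent_prod (\<lambda>k. 1 - A * Q ^ k)"
    using summable_qpoch[of A] by (intro summable_imp_abs_convergent_prod) simp
  then show ?thesis by (rule abs_convergent_prod_imp_convergent_prod)
qed

lemma qpoch_LIMSEQ: "(\<lambda>n. \<Prod>k<n. 1 - A * Q ^ k) \<longlonglongrightarrow> qpoch A q"
proof -
  have "(\<lambda>n. \<Prod>k\<le>n. 1 - A * Q ^ k) \<longlonglongrightarrow> qpoch A q"
    using convergent_prod_LIMSEQ[OF convergent_prod_qpoch[of A]] by (simp add: qpoch_def Q_def)
  then have "(\<lambda>n. \<Prod>k<Suc n. 1 - A * Q ^ k) \<longlonglongrightarrow> qpoch A q"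
    by (simp only: lessThan_Suc_atMost)
  then show ?thesis by (rule LIMSEQ_imp_Suc)
qed

text \<open>A convergent infinite product vanishes only if one of its factors does.\<close>

lemma qpoch_nonzero_iff: "qpoch A q \<noteq> 0 \<longleftrightarrow> (\<forall>k. A * Q ^ k \<noteq> 1)"
proof -
  have "(\<lambda>k. 1 - A * Q ^ k) has_prod qpoch A q"
    using convergent_prod_has_prod[OF convergent_prod_qpoch[of A]] by (simp add: qpoch_def Q_def)
  from has_prod_eq_0_iff[OF this] show ?thesis by auto
qed

lemma qpoch_nonzero:
  assumes "norm A < 1" shows "qpoch A q \<noteq> 0"
proof -
  have "A * Q ^ k \<noteq> 1" for k
  proof
    assume "A * Q ^ k = 1"
    then have "norm A * norm Q ^ k = 1" by (metis norm_mult norm_power norm_one)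
    moreover have "norm A * norm Q ^ k \<le> norm A * 1"
      using Q_norm_less_1 by (intro mult_left_mono power_le_one) auto
    ultimately show False using assms by simp
  qed
  then show ?thesis by (simp add: qpoch_nonzero_iff)
qed

text \<open>By 1 + x <= exp x and the geometric series. The bound does not depend on n or A, so it
  also dominates the truncated weights in \<open>moment_weight\<close>.\<close>

lemma norm_qpoch_partial_le:
  assumes "norm A \<le> 1" shows "norm (\<Prod>k<n. 1 - A * Q ^ k) \<le> exp (1 / (1 - q))"
proof -
  have "norm (\<Prod>k<n. 1 - A * Q ^ k) = (\<Prod>k<n. norm (1 - A * Q ^ k))"
    by (rule prod_norm[symmetric])
  also have "\<dots> \<le> (\<Prod>k<n. 1 + q ^ k)"
  proof (intro prod_mono conjI norm_ge_zero)
    fix k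
    have "norm (1 - A * Q ^ k) \<le> 1 + norm (A * Q ^ k)"
      by (metis norm_one norm_triangle_ineq4)
    also have "norm (A * Q ^ k) \<le> 1 * q ^ k"
      using assms q_pos by (simp add: norm_mult norm_power Q_norm mult_right_mono)
    finally show "norm (1 - A * Q ^ k) \<le> 1 + q ^ k" by simp
  qed
  also have "\<dots> \<le> exp (\<Sum>k<n. q ^ k)"
    using q_pos by (intro prod_le_exp_sum) auto
  also have "(\<Sum>k<n. q ^ k) \<le> 1 / (1 - q)"
    using q_pos q_less_1 sum_le_suminf[of "\<lambda>k. q ^ k" "{..<n}"] suminf_geometric[of q]
    by (auto simp: summable_geometric)
  finally show ?thesis by simp
qed

lemma norm_qpoch_le:
  assumes "norm A \<le> 1" shows "norm (qpoch A q) \<le> exp (1 / (1 - q))"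
  using norm_qpoch_partial_le[OF assms]
  by (intro LIMSEQ_le_const2[OF tendsto_norm[OF qpoch_LIMSEQ]]) auto

section \<open>Euler's expansion of (A;q)_infinity, with coefficients (-1)^n q^(n(n-1)/2) /
  (q;q)_n\<close>

definition euler_coeff :: "nat \<Rightarrow> complex" where
  "euler_coeff n = (\<Prod>k<n. - (Q ^ k) / (1 - Q ^ Suc k))"

lemma euler_coeff_0: "euler_coeff 0 = 1"
  and euler_coeff_Suc: "euler_coeff (Suc n) * (1 - Q ^ Suc n) = - (Q ^ n) * euler_coeff n"
  using one_minus_Q_power_nonzero by (auto simp: euler_coeff_def)

lemma euler_ratio: "(\<lambda>n. - (Q ^ n) / (1 - Q ^ Suc n)) \<longlonglongrightarrow> 0"
proof -
  have "(\<lambda>n. - (Q ^ n) / (1 - Q ^ Suc n)) \<longlonglongrightarrow> - 0 / (1 - 0)"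
    by (intro tendsto_intros LIMSEQ_power_zero LIMSEQ_Suc[OF LIMSEQ_power_zero] Q_norm_less_1) auto
  then show ?thesis by simp
qed

lemma summable_euler: "summable (\<lambda>n. euler_coeff n * A ^ n)"
proof -
  \<comment> \<open>The quotient of consecutive terms tends to 0 for every A, so the series is
    entire; 1/2 is an arbitrary ratio below 1.\<close>
  have "(\<lambda>n. norm (- (Q ^ n) / (1 - Q ^ Suc n) * A)) \<longlonglongrightarrow> 0"
    using tendsto_norm_zero[OF tendsto_mult_left_zero[OF euler_ratio]] by simp
  then have "\<forall>\<^sub>F n in sequentially. norm (- (Q ^ n) / (1 - Q ^ Suc n) * A) < 1 / 2"
    by (rule order_tendstoD(2)) auto
  then obtain N where N: "\<And>n. n \<ge> N \<Longrightarrow> norm (- (Q ^ n) / (1 - Q ^ Suc n) * A) < 1 / 2"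
    by (auto simp: eventually_sequentially)
  show ?thesis
  proof (rule summable_ratio_test)
    fix n assume "n \<ge> N"
    have "euler_coeff (Suc n) * A ^ Suc n
        = (- (Q ^ n) / (1 - Q ^ Suc n) * A) * (euler_coeff n * A ^ n)"
      by (simp add: euler_coeff_def)
    then have "norm (euler_coeff (Suc n) * A ^ Suc n)
        = norm (- (Q ^ n) / (1 - Q ^ Suc n) * A) * norm (euler_coeff n * A ^ n)"
      by (simp only: norm_mult)
    also have "\<dots> \<le> 1 / 2 * norm (euler_coeff n * A ^ n)"
      using N[OF \<open>n \<ge> N\<close>] by (intro mult_right_mono) auto
    finally show "norm (euler_coeff (Suc n) * A ^ Suc n) \<le> 1 / 2 * norm (euler_coeff n * A ^ n)" .
  qed simp
qed

definition euler_sum :: "complex \<Rightarrow> complex" where "euler_sum A = (\<Sum>n. euler_coeff n * A ^ n)"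

lemma euler_sum_field_differentiable: "euler_sum field_differentiable at A"
  unfolding euler_sum_def field_differentiable_def
  using termdiffs_strong_converges_everywhere[OF summable_euler] by blast

lemma euler_sum_shift: "euler_sum A = (1 - A) * euler_sum (Q * A)"
proof -
  have s1: "(\<lambda>n. euler_coeff n * A ^ n) sums euler_sum A"
    and s2: "(\<lambda>n. euler_coeff n * (Q * A) ^ n) sums euler_sum (Q * A)"
    unfolding euler_sum_def using summable_euler by (auto intro: summable_sums)
  \<comment> \<open>Multiplication by A shifts the index by one; padding with 0 at index 0 lets the
    two series be subtracted term by term.\<close>
  have "(\<lambda>n. case n of 0 \<Rightarrow> 0 | Suc m \<Rightarrow> euler_coeff m * (Q * A) ^ m * A) sums (euler_sum (Q * A)
      * A)"
    using sums_Suc[of "\<lambda>n. case n of 0 \<Rightarrow> 0 | Suc m \<Rightarrow> euler_coeff m * (Q * A) ^ m * A"]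
      sums_mult2[OF s2, of A] by simp
  from sums_diff[OF s2 this]
  have "(\<lambda>n. euler_coeff n * A ^ n) sums (euler_sum (Q * A) - euler_sum (Q * A) * A)"
  proof (rule sums_cong[THEN iffD1, rotated])
    fix n
    show "euler_coeff n * (Q * A) ^ n
        - (case n of 0 \<Rightarrow> 0 | Suc m \<Rightarrow> euler_coeff m * (Q * A) ^ m * A) = euler_coeff n * A ^ n"
    proof (cases n)
      case (Suc m)
      have "euler_coeff n * (1 - Q ^ n) = - (Q ^ m) * euler_coeff m"
        using euler_coeff_Suc[of m] Suc by simp
      then have "euler_coeff n * Q ^ n - Q ^ m * euler_coeff m = euler_coeff n"
        by (simp add: algebra_simps)
      moreover have "euler_coeff n * (Q * A) ^ n - euler_coeff m * (Q * A) ^ m * A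
         = (euler_coeff n * Q ^ n - Q ^ m * euler_coeff m) * A ^ n"
        using Suc by (simp add: power_mult_distrib algebra_simps)
      ultimately show ?thesis using Suc by simp
    qed auto
  qed
  then have "euler_sum A = euler_sum (Q * A) - euler_sum (Q * A)
      * A" using s1 by (metis sums_unique2)
  then show ?thesis by (simp add: algebra_simps)
qed

text \<open>Iterating \<open>euler_sum_shift\<close> splits off the first n factors and moves the
  argument to A q^n, which tends to 0, where the sum is continuous with value 1. The point is that
  the infinite product becomes an entire function of A.\<close>

lemma qpoch_eq_euler_sum: "qpoch A q = euler_sum A"
proof -
  have iter: "euler_sum A = (\<Prod>k<n. 1 - A * Q ^ k) * euler_sum (A * Q ^ n)" for n
  proof (induction n)
    case (Suc n)
    then show ?case using euler_sum_shift[of "A * Q ^ n"] by (simp add: mult_ac)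
  qed simp
  have E0: "euler_sum 0 = 1"
    unfolding euler_sum_def using powser_zero[of euler_coeff] by (simp add: euler_coeff_0)
  have "isCont euler_sum 0"
    using euler_sum_field_differentiable field_differentiable_imp_continuous_at by blast
  moreover have "(\<lambda>n. A * Q ^ n) \<longlonglongrightarrow> 0"
    using tendsto_mult_right_zero[OF LIMSEQ_power_zero[OF Q_norm_less_1]] by simp
  ultimately have "(\<lambda>n. euler_sum (A * Q ^ n)) \<longlonglongrightarrow> euler_sum 0"
    by (rule isCont_tendsto_compose)
  from tendsto_mult[OF qpoch_LIMSEQ[of A] this]
  have "(\<lambda>n. euler_sum A) \<longlonglongrightarrow> qpoch A q * euler_sum 0" unfolding iter[symmetric] .
  then show ?thesis using E0 by (simp add: LIMSEQ_const_iff)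
qed

lemma qpoch_field_differentiable: "(\<lambda>A. qpoch A q) field_differentiable at A"
  using euler_sum_field_differentiable by (simp add: qpoch_eq_euler_sum[abs_def])

section \<open>Continuous q-Hermite polynomials and their Poisson kernel\<close>

definition qf :: "nat \<Rightarrow> complex" where "qf n = (\<Prod>k<n. 1 - Q ^ Suc k)"

lemma qf_0 [simp]: "qf 0 = 1" and qf_Suc: "qf (Suc n) = qf n * (1 - Q ^ Suc n)"
  by (auto simp: qf_def)

lemma qf_nonzero [simp]: "qf n \<noteq> 0"
  using one_minus_Q_power_nonzero by (auto simp: qf_def)

lemma norm_qf_le: "norm (qf n) \<le> exp (1 / (1 - q))"
  using norm_qpoch_partial_le[of Q n] q_pos q_less_1 by (simp add: qf_def Q_norm mult_ac)

lemma qf_LIMSEQ: "qf \<longlonglongrightarrow> qpoch Q q"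
  using qpoch_LIMSEQ[of Q] by (simp add: qf_def[abs_def] mult_ac)

lemma qpoch_Q_nonzero: "qpoch Q q \<noteq> 0"
  using qpoch_nonzero Q_norm_less_1 by blast

lemma inverse_qf_bounded: "\<exists>\<beta>. \<forall>n. norm (1 / qf n) \<le> \<beta>"
proof -
  have "(\<lambda>n. 1 / qf n) \<longlonglongrightarrow> 1 / qpoch Q q"
    by (intro tendsto_intros qf_LIMSEQ qpoch_Q_nonzero)
  then have "Bseq (\<lambda>n. 1 / qf n)" by (intro convergent_imp_Bseq convergentI)
  then show ?thesis by (auto simp: Bseq_def)
qed

text \<open>This is \<open>H\<^sub>n(cos \<theta> | q) / (q; q)\<^sub>n\<close> at \<open>z = exp (\<i> \<theta>)\<close>.\<close>

definition qherm :: "nat \<Rightarrow> complex \<Rightarrow> complex" where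
  "qherm n z = (\<Sum>k\<le>n. z ^ k / qf k * ((1 / z) ^ (n - k) / qf (n - k)))"

text \<open>The substitution t -> q t. An infinite q-product in t is characterised by a first-order
  equation relating its series to the dilated one, so product identities reduce to comparing
  coefficients.\<close>

definition dil :: "complex fps \<Rightarrow> complex fps" where "dil f = f oo (fps_const Q * fps_X)"

lemma dil_nth [simp]: "fps_nth (dil f) n = Q ^ n * fps_nth f n"
  by (simp add: dil_def)

lemma dil_mult: "dil (f * g) = dil f * dil g"
  by (simp add: dil_def fps_compose_mult_distrib)

text \<open>The expansion of 1 / (z t; q)_infinity in powers of t.\<close>

definition expq :: "complex \<Rightarrow> complex fps" where "expq z = Abs_fps (\<lambda>n. z ^ n / qf n)"

lemma dil_expq: "dil (expq z) = (1 - fps_const z * fps_X) * expq z"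
proof (rule fps_ext)
  fix n show "fps_nth (dil (expq z)) n = fps_nth ((1 - fps_const z * fps_X) * expq z) n"
  proof (cases n)
    case (Suc m)
    then show ?thesis using one_minus_Q_power_nonzero[of m]
      by (simp add: expq_def qf_Suc left_diff_distrib mult.assoc field_simps)
  qed (simp add: expq_def left_diff_distrib mult.assoc)
qed

text \<open>The Cauchy product behind the generating function 1 / (t z, t/z; q)_infinity of the
  q-Hermite polynomials.\<close>

lemma qherm_fps: "Abs_fps (\<lambda>n. qherm n z) = expq z * expq (1 / z)"
  by (rule fps_ext) (simp add: qherm_def expq_def fps_mult_nth atLeast0AtMost)

lemma qherm_0 [simp]: "qherm 0 z = 1" by (simp add: qherm_def)

text \<open>Each factor of the generating function contributes a linear polynomial under dilation.
  Read coefficientwise, this is the three-term recurrence with z + 1/z = 2 cos(angle).\<close>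

lemma qherm_recurrence_fps:
  assumes "z \<noteq> 0"
  shows "dil (Abs_fps (\<lambda>n. qherm n z))
    = (1 - fps_const (z + 1 / z) * fps_X + fps_X ^ 2) * Abs_fps (\<lambda>n. qherm n z)"
proof -
  have "fps_const z * fps_const (1 / z) = 1"
    using assms by (simp add: fps_const_mult)
  then have "(1 - fps_const z * fps_X) * (1 - fps_const (1 / z) * fps_X)
     = 1 - fps_const (z + 1 / z) * fps_X + fps_X ^ 2"
    by (simp add: algebra_simps power2_eq_square flip: fps_const_add)
  then show ?thesis
    by (simp add: qherm_fps dil_mult dil_expq mult_ac)
qed

lemma qherm_Suc_0:
  assumes "z \<noteq> 0" shows "(1 - Q) * qherm (Suc 0) z = z + 1 / z"
  using arg_cong[OF qherm_recurrence_fps[OF assms], of "\<lambda>f. fps_nth f (Suc 0)"]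
  by (simp add: algebra_simps power2_eq_square)

lemma qherm_Suc_Suc:
  assumes "z \<noteq> 0"
  shows "(1 - Q ^ Suc (Suc n)) * qherm (Suc (Suc n)) z = (z + 1 / z) * qherm (Suc n) z - qherm n z"
proof -
  have "Q ^ Suc (Suc n) * qherm (Suc (Suc n)) z
    = qherm (Suc (Suc n)) z - (z + 1 / z) * qherm (Suc n) z + qherm n z"
    using arg_cong[OF qherm_recurrence_fps[OF assms], of "\<lambda>f. fps_nth f (Suc (Suc n))"]
    by (simp add: left_diff_distrib distrib_right mult.assoc power2_eq_square del: power_Suc)
  then show ?thesis by (simp add: algebra_simps)
qed

text \<open>On the unit circle \<open>qherm n z\<close> has n + 1 terms, each bounded by the square
  of the bound on 1/(q;q)_k.\<close>

lemma qherm_bounded: "\<exists>C\<ge>0. \<forall>n z. norm z = 1 \<longrightarrow> norm (qherm n z) \<le> C * (real n + 1)"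
proof -
  obtain \<beta> where \<beta>: "\<And>n. norm (1 / qf n) \<le> \<beta>" using inverse_qf_bounded by blast
  have "\<beta> \<ge> 0" using \<beta>[of 0] by (metis norm_ge_zero order_trans)
  have "norm (qherm n z) \<le> \<beta> * \<beta> * (real n + 1)" if "norm z = 1" for n z
  proof -
    have "norm (qherm n z) \<le> (\<Sum>k\<le>n. norm (z ^ k / qf k * ((1 / z) ^ (n - k) / qf (n - k))))"
      unfolding qherm_def by (rule norm_sum)
    also have "\<dots> = (\<Sum>k\<le>n. norm (1 / qf k) * norm (1 / qf (n - k)))"
      using that by (simp add: norm_mult norm_divide norm_power power_one)
    also have "\<dots> \<le> (\<Sum>k\<le>n. \<beta> * \<beta>)"
      by (intro sum_mono mult_mono \<beta> \<open>\<beta> \<ge> 0\<close>) auto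
    finally show ?thesis by (simp add: algebra_simps)
  qed
  then show ?thesis using \<open>\<beta> \<ge> 0\<close> by (intro exI[of _ "\<beta> * \<beta>"]) auto
qed

text \<open>Chosen once, so that all later dominating series share one explicit constant.\<close>

definition qherm_bound :: real where
  "qherm_bound = (SOME C. C \<ge> 0 \<and> (\<forall>n z. norm z = 1 \<longrightarrow> norm (qherm n z) \<le> C * (real n + 1)))"

lemma qherm_bound_nonneg: "qherm_bound \<ge> 0" and norm_qherm_le: "norm z = 1 \<Longrightarrow> norm (qherm n z)
    \<le> qherm_bound * (real n + 1)"
  using someI_ex[of "\<lambda>C. C \<ge> 0 \<and> (\<forall>n z. norm z = 1 \<longrightarrow> norm (qherm n z) \<le> C * (real n + 1))"]
    qherm_bounded unfolding qherm_bound_def by blast+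

section \<open>The Poisson kernel and its q-difference equation\<close>

definition poisson_coeff :: "complex \<Rightarrow> complex \<Rightarrow> nat \<Rightarrow> complex" where
  "poisson_coeff z y n = qf n * qherm n z * qherm n y"

text \<open>The two three-term recurrences combine to a five-term recurrence for the products
  \<open>a\<^sub>n b\<^sub>n\<close>. Here \<open>a4, a3, \<dots>, a0\<close> are consecutive values, in increasing order of the index.\<close>

lemma poly4_identity:
  fixes X Y :: complex
  assumes "p2 * a2 = X * a3 - a4" "p1 * a1 = X * a2 - a3" "p0 * a0 = X * a1 - a2"
    and "p2 * b2 = Y * b3 - b4" "p1 * b1 = Y * b2 - b3" "p0 * b0 = Y * b1 - b2"
  shows "p3 * p2 * p1 * (p0 * a0) * (p0 * b0) - X * Y * (p3 * p2 * p1 * a1 * b1)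
      + (X\<^sup>2 + Y\<^sup>2 - 2) * (p3 * p2 * a2 * b2) - X * Y * (p3 * a3 * b3) + a4 * b4
    = (p2 + p1 - 2) * (p3 * p2 * a2 * b2) + (1 - p3) * (a4 * b4)"
proof -
  \<comment> \<open>Both recurrences are solved downwards, so everything is expressed by
    \<open>a1\<close>, \<open>a2\<close>, \<open>b1\<close>, \<open>b2\<close>; the top values occur
    only as \<open>p0 * a0\<close> and \<open>p0 * b0\<close>. No division arises and a polynomial
    identity remains.\<close>
  have a4: "a4 = X * a3 - p2 * a2" "a3 = X * a2 - p1 * a1"
    and b4: "b4 = Y * b3 - p2 * b2" "b3 = Y * b2 - p1 * b1"
    using assms by (auto simp: algebra_simps)
  show ?thesis
    unfolding assms(3,6) unfolding a4(1) b4(1) unfolding a4(2) b4(2) by algebra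
qed

text \<open>The coefficient of t^(n+4) in the q-difference equation of the kernel, with the term
  Q^(n+4) of the dilated series moved to the left. It is \<open>poly4_identity\<close> multiplied by
  the common factor \<open>qf n\<close>.\<close>

lemma poisson_coeff_Suc:
  assumes "z \<noteq> 0" "y \<noteq> 0"
  defines "X \<equiv> z + 1 / z" and "Y \<equiv> y + 1 / y"
  shows "(1 - Q ^ (n + 4)) * poisson_coeff z y (n + 4) - X * Y * poisson_coeff z y (n + 3)
      + (X\<^sup>2 + Y\<^sup>2 - 2) * poisson_coeff z y (n + 2) - X * Y * poisson_coeff z y (n + 1)
          + poisson_coeff z y n
    = - ((1 + Q) * Q ^ (n + 2)) * poisson_coeff z y (n + 2) + Q * Q ^ n * poisson_coeff z y n"
proof -
  let ?p = "\<lambda>k. 1 - Q ^ (n + k)"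
  note rec = qherm_Suc_Suc[OF assms(1), folded X_def] qherm_Suc_Suc[OF assms(2), folded Y_def]
  have u: "poisson_coeff z y (n + 1) = qf n * (?p 1 * qherm (n + 1) z * qherm (n + 1) y)"
    "poisson_coeff z y (n + 2) = qf n * (?p 1 * ?p 2 * qherm (n + 2) z * qherm (n + 2) y)"
    "poisson_coeff z y (n + 3) = qf n * (?p 1 * ?p 2 * ?p 3 * qherm (n + 3) z * qherm (n + 3) y)"
    "(1 - Q ^ (n + 4)) * poisson_coeff z y (n + 4)
      = qf n * (?p 1 * ?p 2 * ?p 3 * (?p 4 * qherm (n + 4) z) * (?p 4 * qherm (n + 4) y))"
    "poisson_coeff z y n = qf n * (qherm n z * qherm n y)"
    by (simp_all add: poisson_coeff_def qf_Suc numeral_eq_Suc)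
  have F: "?p 1 * ?p 2 * ?p 3 * (?p 4 * qherm (n + 4) z) * (?p 4 * qherm (n + 4) y)
      - X * Y * (?p 1 * ?p 2 * ?p 3 * qherm (n + 3) z * qherm (n + 3) y)
      + (X\<^sup>2 + Y\<^sup>2 - 2) * (?p 1 * ?p 2 * qherm (n + 2) z * qherm (n + 2) y)
      - X * Y * (?p 1 * qherm (n + 1) z * qherm (n + 1) y) + qherm n z * qherm n y
    = (?p 2 + ?p 3 - 2) * (?p 1 * ?p 2 * qherm (n + 2) z * qherm (n + 2) y)
      + (1 - ?p 1) * (qherm n z * qherm n y)"
    using rec[of n] rec[of "n + 1"] rec[of "n + 2"]
    by (intro poly4_identity) (simp_all add: numeral_eq_Suc)
  have e: "?p 2 + ?p 3 - 2 = - ((1 + Q) * Q ^ (n + 2))" "1 - ?p 1 = Q * Q ^ n"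
    by (simp_all add: numeral_eq_Suc algebra_simps)
  have scale: "v * A - c * (v * B) + s * (v * C) - c * (v * D) + v * F = t * (v * C) + w * (v * F)"
    if "A - c * B + s * C - c * D + F = t * C + w * F" for v A B C D F c s t w :: complex
    using that by algebra
  show ?thesis
    unfolding u by (rule scale[OF F[unfolded e]])
qed

lemma summable_poly_geometric:
  assumes "0 \<le> r" "r < (1::real)"
  shows "summable (\<lambda>n. (real n + 1) ^ 2 * r ^ n)"
\<comment> \<open>The ratio test needs positive terms, hence the separate case.\<close>
proof (cases "r = 0")
  case True
  have "summable (\<lambda>n. (real n + 1) ^ 2 * (0::real) ^ n)"
    by (rule summable_finite[of "{0}"]) auto
  then show ?thesis using True by simp
next
  case False
  show ?thesis
  proof (rule ratio_test_convergence)
    show "\<forall>\<^sub>F n in sequentially. (real n + 1) ^ 2 * r ^ n > 0"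
      using assms False by (intro always_eventually) auto
    have "(\<lambda>n. ((real n + 1) / (real n + 2)) ^ 2 * (1 / r)) \<longlonglongrightarrow> 1 ^ 2 * (1 / r)"
    proof (intro tendsto_intros)
      have "(\<lambda>n. 1 - 1 / real (n + 2)) \<longlonglongrightarrow> 1 - 0"
        by (intro tendsto_intros LIMSEQ_ignore_initial_segment[OF lim_1_over_n])
      moreover have "(real n + 1) / (real n + 2) = 1 - 1 / real (n + 2)" for n
        by (simp add: field_simps)
      ultimately show "(\<lambda>n. (real n + 1) / (real n + 2)) \<longlonglongrightarrow> 1" by simp
    qed
    moreover have "((real n + 1) / (real n + 2)) ^ 2 * (1 / r)
       = ((real n + 1) ^ 2 * r ^ n) / ((real (Suc n) + 1) ^ 2 * r ^ Suc n)" for n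
      using False by (simp add: power_divide field_simps)
    ultimately have lim: "(\<lambda>n. ((real n + 1) ^ 2 * r ^ n) / ((real (Suc n) + 1) ^ 2
        * r ^ Suc n)) \<longlonglongrightarrow> 1 / r"
      by simp
    have "liminf (\<lambda>n. ereal (((real n + 1) ^ 2 * r ^ n) / ((real (Suc n) + 1) ^ 2 * r ^ Suc n)))
        = ereal (1 / r)"
      using lim by (intro lim_imp_Liminf) (auto intro: tendsto_ereal)
    also have "1 < ereal (1 / r)" using assms False by simp
    finally show "1 < liminf (\<lambda>n. ereal (((real n + 1) ^ 2 * r ^ n) / ((real (Suc n) + 1) ^ 2
        * r ^ Suc n)))" .
  qed
qed

definition poisson_coeff_bound :: real where "poisson_coeff_bound = exp (1 / (1 - q))
    * qherm_bound ^ 2"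

lemma norm_poisson_coeff_le:
  assumes "norm z = 1" "norm y = 1"
  shows "norm (poisson_coeff z y n) \<le> poisson_coeff_bound * (real n + 1) ^ 2"
proof -
  have "norm (poisson_coeff z y n) = norm (qf n) * norm (qherm n z) * norm (qherm n y)"
    by (simp add: poisson_coeff_def norm_mult)
  also have "\<dots> \<le> exp (1 / (1 - q)) * (qherm_bound * (real n + 1)) * (qherm_bound * (real n + 1))"
    using assms qherm_bound_nonneg by (intro mult_mono norm_qf_le norm_qherm_le) auto
  finally show ?thesis by (simp add: poisson_coeff_bound_def power2_eq_square mult_ac)
qed

lemma summable_poisson_coeff:
  assumes "norm z = 1" "norm y = 1" "norm r < 1"
  shows "summable (\<lambda>n. norm (poisson_coeff z y n * r ^ n))"
proof (rule summable_comparison_test')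
  show "summable (\<lambda>n. poisson_coeff_bound * ((real n + 1) ^ 2 * norm r ^ n))"
    using assms by (intro summable_mult summable_poly_geometric) auto
  fix n
  have "norm (poisson_coeff z y n) * norm r ^ n \<le> poisson_coeff_bound * (real n + 1) ^ 2
      * norm r ^ n"
    by (intro mult_right_mono norm_poisson_coeff_le assms) auto
  then show "norm (norm (poisson_coeff z y n * r ^ n)) \<le> poisson_coeff_bound * ((real n + 1) ^ 2
      * norm r ^ n)"
    by (simp add: norm_mult norm_power mult.assoc)
qed

text \<open>The Poisson kernel as a function of r. Its coefficients carry \<open>qf n\<close> in the
  numerator because each of the two \<open>qherm\<close> factors is already divided by
  (q;q)_n.\<close>

definition mehler :: "complex \<Rightarrow> complex \<Rightarrow> complex \<Rightarrow> complex" where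
  "mehler z y r = (\<Sum>n. poisson_coeff z y n * r ^ n)"

lemma conv_radius_poisson_coeff:
  assumes "norm z = 1" "norm y = 1"
  shows "conv_radius (poisson_coeff z y) \<ge> 1"
proof (rule conv_radius_geI_ex')
  fix r :: real assume "0 < r" "ereal r < 1"
  then have "norm (of_real r :: complex) < 1" by simp
  from summable_norm_cancel[OF summable_poisson_coeff[OF assms this]]
  show "summable (\<lambda>n. poisson_coeff z y n * of_real r ^ n)" .
qed

text \<open>The coefficients of t, t^2 and t^3, where the five-term recurrence would reach negative
  indices. Here w stands for q, and \<open>u1\<close>, \<open>u2\<close>, \<open>u3\<close> are the
  first Poisson coefficients; the coefficient of index 0 is 1.\<close>

lemma initial_identities:
  fixes X Y w :: complex
  assumes "(1 - w) * a1 = X" "(1 - w) * b1 = Y"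
    and "(1 - w ^ 2) * a2 = X * a1 - 1" "(1 - w ^ 2) * b2 = Y * b1 - 1"
    and "(1 - w ^ 3) * a3 = X * a2 - a1" "(1 - w ^ 3) * b3 = Y * b2 - b1"
  defines "u1 \<equiv> (1 - w) * a1 * b1" and "u2 \<equiv> (1 - w) * (1 - w ^ 2) * a2 * b2"
    and "u3 \<equiv> (1 - w) * (1 - w ^ 2) * (1 - w ^ 3) * a3 * b3"
  shows "u1 - X * Y = w * u1"
    and "u2 - X * Y * u1 + (X\<^sup>2 + Y\<^sup>2 - 2) = w ^ 2 * u2 - (1 + w)"
    and "u3 - X * Y * u2 + (X\<^sup>2 + Y\<^sup>2 - 2) * u1 - X * Y = w ^ 3 * u3 - (1 + w) * (w * u1)"
proof -
  have 1: "(1 - w) * u1 = X * Y" unfolding u1_def assms(1,2)[symmetric] by algebra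
  then show "u1 - X * Y = w * u1" by (simp add: algebra_simps)
  have "(1 - w ^ 2) * u2 = (1 - w) * ((1 - w ^ 2) * a2) * ((1 - w ^ 2) * b2)"
    unfolding u2_def by (simp add: mult_ac)
  also have "\<dots> = (1 - w) * (X * a1 - 1) * (Y * b1 - 1)" using assms by simp
  also have "\<dots> = X * Y * u1 - X * X - Y * Y + (1 - w)"
    unfolding u1_def assms(1,2)[symmetric] by algebra
  finally show "u2 - X * Y * u1 + (X\<^sup>2 + Y\<^sup>2 - 2) = w ^ 2 * u2 - (1 + w)"
    by algebra
  have "(1 - w ^ 3) * u3 = (1 - w) * (1 - w ^ 2) * ((1 - w ^ 3) * a3) * ((1 - w ^ 3) * b3)"
    unfolding u3_def by (simp add: mult_ac)
  also have "\<dots> = (1 - w) * (1 - w ^ 2) * (X * a2 - a1) * (Y * b2 - b1)" using assms by simp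
  also have "\<dots> = X * Y * u2 - (1 - w) * (X * ((1 - w ^ 2) * a2) * b1 + Y * ((1 - w ^ 2) * b2) * a1)
     + (1 - w) * (1 - w ^ 2) * a1 * b1"
    unfolding u2_def by algebra
  also have "\<dots> = X * Y * u2 - (1 - w) * (X * (X * a1 - 1) * b1 + Y * (Y * b1 - 1) * a1)
     + (1 - w) * (1 - w ^ 2) * a1 * b1"
    using assms by simp
  also have "\<dots> = X * Y * u2 - (X * X + Y * Y) * u1 + X * ((1 - w) * b1) + Y * ((1 - w) * a1)
     + (1 - w ^ 2) * u1"
    unfolding u1_def by algebra
  also have "\<dots> = X * Y * u2 - (X * X + Y * Y) * u1 + X * Y + (1 - w) * u1
     + (1 - w ^ 2) * u1"
    using assms 1 by (simp add: mult.commute)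
  finally show "u3 - X * Y * u2 + (X\<^sup>2 + Y\<^sup>2 - 2) * u1 - X * Y = w ^ 3 * u3 - (1 + w) * (w * u1)"
    by algebra
qed

text \<open>The first polynomial factor is \<open>(1 - t z y) (1 - t z/y) (1 - t y/z) (1 - t/(z y))\<close>, the second
  \<open>(1 - t\<^sup>2) (1 - q t\<^sup>2)\<close>: this is the q-difference equation of the product side of the Poisson
      kernel.\<close>

lemma poisson_coeff_recurrence:
  assumes "z \<noteq> 0" "y \<noteq> 0"
  defines "X \<equiv> z + 1 / z" and "Y \<equiv> y + 1 / y"
  shows "(1 - fps_const (X * Y) * fps_X + fps_const (X\<^sup>2 + Y\<^sup>2 - 2) * fps_X ^ 2
       - fps_const (X * Y) * fps_X ^ 3 + fps_X ^ 4) * Abs_fps (poisson_coeff z y)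
     = (1 - fps_const (1 + Q) * fps_X ^ 2 + fps_const Q * fps_X ^ 4)
         * dil (Abs_fps (poisson_coeff z y))"
    (is "?L = ?R")
proof (rule fps_ext)
  fix n :: nat
  have qz: "1 - Q \<noteq> 0" "1 - Q ^ 2 \<noteq> 0" "1 - Q ^ 3 \<noteq> 0"
    using one_minus_Q_power_nonzero[of 0] one_minus_Q_power_nonzero[of 1]
      one_minus_Q_power_nonzero[of 2] by (simp_all add: numeral_eq_Suc)
  have h1: "(1 - Q) * qherm 1 z = X" "(1 - Q) * qherm 1 y = Y"
    using qherm_Suc_0[OF assms(1), folded X_def] qherm_Suc_0[OF assms(2), folded Y_def] by simp_all
  note rec = qherm_Suc_Suc[OF assms(1), folded X_def] qherm_Suc_Suc[OF assms(2), folded Y_def]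
  have h2: "(1 - Q ^ 2) * qherm 2 z = X * qherm 1 z - 1" "(1 - Q ^ 2) * qherm 2 y = Y
      * qherm 1 y - 1"
    using rec[of 0] by (simp_all add: numeral_eq_Suc)
  have h3: "(1 - Q ^ 3) * qherm 3 z = X * qherm 2 z - qherm 1 z" "(1 - Q ^ 3) * qherm 3 y = Y
      * qherm 2 y - qherm 1 y"
    using rec[of 1] by (simp_all add: numeral_eq_Suc)
  have u: "poisson_coeff z y 0 = 1" "poisson_coeff z y 1 = (1 - Q) * qherm 1 z * qherm 1 y"
    "poisson_coeff z y 2 = (1 - Q) * (1 - Q ^ 2) * qherm 2 z * qherm 2 y"
    "poisson_coeff z y 3 = (1 - Q) * (1 - Q ^ 2) * (1 - Q ^ 3) * qherm 3 z * qherm 3 y"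
    by (simp_all add: poisson_coeff_def qf_def numeral_eq_Suc lessThan_Suc)
  have nth: "fps_nth (fps_const c * fps_X ^ k * f) j = (if j < k then 0 else c * fps_nth f (j - k))"
    "fps_nth (fps_X ^ k * f) j = (if j < k then 0 else fps_nth f (j - k))"
    "fps_nth (fps_const c * fps_X * f) j = (if j < 1 then 0 else c * fps_nth f (j - 1))"
    for c :: complex and j k f
    by (simp_all add: mult.assoc fps_X_power_mult_nth)
  \<comment> \<open>The polynomial factors have degree 4, so the general recurrence applies from
    index 4 on.\<close>
  have "n \<in> {0, 1, 2, 3} \<or> (\<exists>m. n = m + 4)"
    by simp presburger
  then consider "n = 0" | "n = 1" | "n = 2" | "n = 3" | m where "n = m + 4"
    by blast
  then show "fps_nth ?L n = fps_nth ?R n"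
  proof cases
    case 1
    then show ?thesis by (simp add: left_diff_distrib distrib_right nth u)
  next
    case 2
    have "poisson_coeff z y 1 - X * Y = Q * poisson_coeff z y 1"
      unfolding u by (rule initial_identities(1)[OF h1 h2 h3])
    with 2 show ?thesis by (simp add: left_diff_distrib distrib_right nth u(1))
  next
    case 3
    have "poisson_coeff z y 2 - X * Y * poisson_coeff z y 1 + (X\<^sup>2 + Y\<^sup>2 - 2) = Q ^ 2
        * poisson_coeff z y 2 - (1 + Q)"
      unfolding u by (rule initial_identities(2)[OF h1 h2 h3])
    with 3 show ?thesis by (simp add: left_diff_distrib distrib_right nth u(1))
  next
    case 4
    have "poisson_coeff z y 3 - X * Y * poisson_coeff z y 2 + (X\<^sup>2 + Y\<^sup>2 - 2)
        * poisson_coeff z y 1 - X * Y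
       = Q ^ 3 * poisson_coeff z y 3 - (1 + Q) * (Q * poisson_coeff z y 1)"
      unfolding u by (rule initial_identities(3)[OF h1 h2 h3])
    with 4 show ?thesis by (simp add: left_diff_distrib distrib_right nth u(1))
  next
    case 5
    have "poisson_coeff z y n - X * Y * poisson_coeff z y (m + 3) + (X\<^sup>2 + Y\<^sup>2 - 2)
        * poisson_coeff z y (m + 2)
        - X * Y * poisson_coeff z y (m + 1) + poisson_coeff z y m
       = Q ^ n * poisson_coeff z y n - (1 + Q) * (Q ^ (m + 2) * poisson_coeff z y (m + 2)) + Q
           * (Q ^ m * poisson_coeff z y m)"
      using poisson_coeff_Suc[OF assms(1,2), of m, folded X_def Y_def] 5 by (simp add:
          algebra_simps)
    then show ?thesis using 5 by (simp add: left_diff_distrib distrib_right nth add.commute[of 3 m])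
  qed
qed

lemma fps_conv_radius_infinity:
  fixes f g :: "complex fps"
  assumes "fps_conv_radius f = \<infinity>" "fps_conv_radius g = \<infinity>"
  shows "fps_conv_radius (f + g) = \<infinity>" "fps_conv_radius (f - g) = \<infinity>" "fps_conv_radius (f * g) = \<infinity>"
  using assms fps_conv_radius_add[of f g] fps_conv_radius_diff[of f g] fps_conv_radius_mult[of f g]
  by simp_all

lemma fps_conv_radius_poisson_coeff: "norm z = 1 \<Longrightarrow> norm y = 1 \<Longrightarrow> norm r < 1
    \<Longrightarrow> ereal (norm r) < fps_conv_radius (Abs_fps (poisson_coeff z y))"
  unfolding fps_conv_radius_def
  using conv_radius_poisson_coeff[of z y] by (simp add: order_less_le_trans[of _ 1])

lemma mehler_eval_fps: "mehler z y r = eval_fps (Abs_fps (poisson_coeff z y)) r"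
  "mehler z y (Q * r) = eval_fps (dil (Abs_fps (poisson_coeff z y))) r"
  by (simp_all add: mehler_def eval_fps_def power_mult_distrib mult_ac)

text \<open>The formal identity \<open>poisson_coeff_recurrence\<close> evaluated at r: the
  polynomials converge everywhere, and both series have radius of convergence at least 1.\<close>

lemma mehler_shift:
  assumes "norm z = 1" "norm y = 1" "norm r < 1"
  shows "(1 - r * z * y) * (1 - r * z / y) * (1 - r * y / z) * (1 - r / (z * y)) * mehler z y r
       = (1 - r\<^sup>2) * (1 - r\<^sup>2 * Q) * mehler z y (Q * r)"
proof -
  have nz: "z \<noteq> 0" "y \<noteq> 0" using assms by auto
  let ?X = "z + 1 / z" and ?Y = "y + 1 / y"
  let ?p = "1 - fps_const (?X * ?Y) * fps_X + fps_const (?X\<^sup>2 + ?Y\<^sup>2 - 2) * fps_X ^ 2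
       - fps_const (?X * ?Y) * fps_X ^ 3 + fps_X ^ 4"
  let ?s = "1 - fps_const (1 + Q) * fps_X ^ 2 + fps_const Q * fps_X ^ 4"
  note R = fps_conv_radius_infinity fps_conv_radius_const fps_conv_radius_1 fps_conv_radius_fps_X
    fps_conv_radius_fps_X_power
  have p: "fps_conv_radius ?p = \<infinity>" and s: "fps_conv_radius ?s = \<infinity>"
    by (intro R)+
  have r: "ereal (norm r) < fps_conv_radius (Abs_fps (poisson_coeff z y))"
    using assms by (rule fps_conv_radius_poisson_coeff)
  have "summable (\<lambda>n. fps_nth (dil (Abs_fps (poisson_coeff z y))) n * w ^ n)" if "norm w < 1" for w
  proof -
    have "norm (Q * w) < 1"
      using that Q_norm_less_1 by (simp add: norm_mult) (metis mult_le_one mult_strict_mono'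
          norm_ge_zero mult_1)
    from summable_norm_cancel[OF summable_poisson_coeff[OF assms(1,2) this]] show ?thesis
      by (simp add: power_mult_distrib mult_ac)
  qed
  then have "fps_conv_radius (dil (Abs_fps (poisson_coeff z y))) \<ge> 1"
    unfolding fps_conv_radius_def by (intro conv_radius_geI_ex') simp
  then have r': "ereal (norm r) < fps_conv_radius (dil (Abs_fps (poisson_coeff z y)))"
    using assms(3) by (simp add: order_less_le_trans[of _ 1])
  have "eval_fps ?p r * mehler z y r = eval_fps ?s r * mehler z y (Q * r)"
    using arg_cong[OF poisson_coeff_recurrence[OF nz], of "\<lambda>f. eval_fps f r"] p s r r'
    by (simp add: eval_fps_mult mehler_eval_fps[of z y r])
  moreover have "eval_fps ?p r = 1 - ?X * ?Y * r + (?X\<^sup>2 + ?Y\<^sup>2 - 2) * r ^ 2 - ?X * ?Y * r ^ 3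
      + r ^ 4"
    by (simp only: R eval_fps_add eval_fps_diff eval_fps_mult eval_fps_const eval_fps_X
        eval_fps_X_power eval_fps_1
       ereal_less_PInfty less_ereal.simps PInfty_neq_ereal)
  moreover have "eval_fps ?s r = (1 - r\<^sup>2) * (1 - r\<^sup>2 * Q)"
    by (simp only: R eval_fps_add eval_fps_diff eval_fps_mult eval_fps_const eval_fps_X
        eval_fps_X_power eval_fps_1
       ereal_less_PInfty less_ereal.simps) algebra
  moreover have "1 - ?X * ?Y * r + (?X\<^sup>2 + ?Y\<^sup>2 - 2) * r ^ 2 - ?X * ?Y * r ^ 3 + r ^ 4
     = (1 - r * z * y) * (1 - r * z / y) * (1 - r * y / z) * (1 - r / (z * y))"
    using nz by (simp add: field_simps) algebra
  ultimately show ?thesis by simp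
qed

text \<open>Replacing r by q r multiplies r^2 by q^2, so each step yields two factors of (r^2;
  q)_infinity; hence 2n on the right.\<close>

lemma mehler_iterate:
  assumes "norm z = 1" "norm y = 1" "norm r < 1"
  shows "(\<Prod>k<n. 1 - (r * z * y) * Q ^ k) * (\<Prod>k<n. 1 - (r * z / y) * Q ^ k)
      * (\<Prod>k<n. 1 - (r * y / z) * Q ^ k) * (\<Prod>k<n. 1 - (r / (z * y)) * Q ^ k) * mehler z y r
    = (\<Prod>k<2 * n. 1 - r\<^sup>2 * Q ^ k) * mehler z y (r * Q ^ n)"
proof (induction n)
  case (Suc n)
  have "norm (r * Q ^ n) < 1"
  proof -
    have "norm (r * Q ^ n) \<le> norm r * 1"
      unfolding norm_mult norm_power using Q_norm_less_1 by (intro mult_left_mono power_le_one) auto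
    then show ?thesis using assms by simp
  qed
  from mehler_shift[OF assms(1,2) this]
  have "(1 - r * z * y * Q ^ n) * (1 - r * z / y * Q ^ n) * (1 - r * y / z * Q ^ n) * (1 - r / (z
      * y) * Q ^ n)
      * mehler z y (r * Q ^ n)
     = (1 - r\<^sup>2 * Q ^ (2 * n)) * (1 - r\<^sup>2 * Q ^ (Suc (2 * n))) * mehler z y (r * Q ^ Suc n)"
    by (simp add: power_mult_distrib mult_ac power_mult[symmetric])
  moreover have "(A * a) * (B * b) * (C * c) * (D * d) * M = (P * v * w) * M'"
    if "A * B * C * D * M = P * M1" "a * b * c * d * M1 = v * w * M'"
    for A B C D a b c d M M' M1 P v w :: complex
    using that by algebra
  ultimately show ?case
    using Suc.IH by simp
qed simp

text \<open>Let n tend to infinity in \<open>mehler_iterate\<close>: the remaining kernel is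
  evaluated at r q^n, which tends to 0, where its value is 1.\<close>

lemma mehler_formula:
  assumes "norm z = 1" "norm y = 1" "norm r < 1"
  shows "qpoch (r * z * y) q * qpoch (r * z / y) q * qpoch (r * y / z) q * qpoch (r / (z * y)) q
     * mehler z y r = qpoch (r\<^sup>2) q"
proof -
  have m0: "mehler z y 0 = 1"
    unfolding mehler_def using powser_zero[of "poisson_coeff z y"] by (simp add: poisson_coeff_def)
  have "isCont (eval_fps (Abs_fps (poisson_coeff z y))) 0"
    using fps_conv_radius_poisson_coeff[OF assms(1,2), of 0] by (intro continuous_eval_fps) auto
  then have "isCont (mehler z y) 0" by (simp add: mehler_eval_fps(1)[abs_def])
  moreover have "(\<lambda>n. r * Q ^ n) \<longlonglongrightarrow> 0"
    using tendsto_mult_right_zero[OF LIMSEQ_power_zero[OF Q_norm_less_1]] by simp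
  ultimately have m: "(\<lambda>n. mehler z y (r * Q ^ n)) \<longlonglongrightarrow> 1"
    using isCont_tendsto_compose m0 by metis
  have "filterlim (\<lambda>n::nat. 2 * n) sequentially sequentially"
    by (intro filterlim_subseq strict_monoI) auto
  from filterlim_compose[OF qpoch_LIMSEQ this]
  have "(\<lambda>n. (\<Prod>k<2 * n. 1 - r\<^sup>2 * Q ^ k) * mehler z y (r * Q ^ n)) \<longlonglongrightarrow> qpoch (r\<^sup>2) q * 1"
    by (intro tendsto_mult m)
  moreover have "(\<lambda>n. (\<Prod>k<n. 1 - (r * z * y) * Q ^ k) * (\<Prod>k<n. 1 - (r * z / y) * Q ^ k)
      * (\<Prod>k<n. 1 - (r * y / z) * Q ^ k) * (\<Prod>k<n. 1 - (r / (z * y)) * Q ^ k) * mehler z y r)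
    \<longlonglongrightarrow> qpoch (r * z * y) q * qpoch (r * z / y) q * qpoch (r * y / z) q * qpoch (r / (z * y)) q
       * mehler z y r"
    by (intro tendsto_mult tendsto_const qpoch_LIMSEQ)
  ultimately show ?thesis
    unfolding mehler_iterate[OF assms] using LIMSEQ_unique by fastforce
qed

section \<open>Orthogonality\<close>

definition eulerq :: "complex \<Rightarrow> complex fps" where "eulerq x = Abs_fps (\<lambda>n. euler_coeff n * x ^ n)"

text \<open>\<open>eulerq x\<close> is the formal series of (x t; q)_infinity, and splitting off the
  first factor of the product leaves its dilation.\<close>

lemma dil_eulerq: "eulerq x = (1 - fps_const x * fps_X) * dil (eulerq x)"
proof (rule fps_ext)
  fix n show "fps_nth (eulerq x) n = fps_nth ((1 - fps_const x * fps_X) * dil (eulerq x)) n"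
  proof (cases n)
    case (Suc m)
    have "euler_coeff (Suc m) = Q ^ Suc m * euler_coeff (Suc m) - Q ^ m * euler_coeff m"
      using euler_coeff_Suc[of m] by (simp add: algebra_simps)
    then have "euler_coeff (Suc m) * x ^ Suc m = (Q ^ Suc m * euler_coeff (Suc m) - Q ^ m
        * euler_coeff m) * x ^ Suc m"
      by simp
    then show ?thesis using Suc
      by (simp add: eulerq_def left_diff_distrib mult.assoc) (simp add: algebra_simps)
  qed (simp add: eulerq_def left_diff_distrib mult.assoc)
qed

text \<open>Coefficient of t^n in (x t; q)_infinity / (t; q)_infinity. The quotient solves a
  first-order q-difference equation, which gives a two-term recursion for its coefficients.\<close>

lemma q_binomial:
  "(\<Sum>k\<le>n. euler_coeff k * x ^ k / qf (n - k)) = (\<Prod>k<n. 1 - x * Q ^ k) / qf n"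
proof -
  let ?G = "eulerq x * expq 1"
  have nth: "fps_nth ?G n = (\<Sum>k\<le>n. euler_coeff k * x ^ k / qf (n - k))" for n
    by (simp add: fps_mult_nth eulerq_def expq_def atLeast0AtMost)
  have "(1 - fps_const x * fps_X) * dil ?G = ((1 - fps_const x * fps_X) * dil (eulerq x))
      * dil (expq 1)"
    by (simp add: dil_mult mult.assoc)
  also have "\<dots> = (1 - fps_X) * ?G"
    unfolding dil_eulerq[symmetric] by (simp add: dil_expq)
  finally have G: "(1 - fps_const x * fps_X) * dil ?G = (1 - fps_X) * ?G" .
  have "fps_nth ?G n = (\<Prod>k<n. 1 - x * Q ^ k) / qf n"
  proof (induction n)
    case 0
    show ?case by (simp add: eulerq_def expq_def euler_coeff_0)
  next
    case (Suc n)
    have "Q ^ Suc n * fps_nth ?G (Suc n) - x * (Q ^ n * fps_nth ?G n)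
        = fps_nth ?G (Suc n) - fps_nth ?G n"
      using arg_cong[OF G, of "\<lambda>f. fps_nth f (Suc n)"]
      by (simp add: left_diff_distrib mult.assoc del: fps_mult_nth_0)
    then have "(1 - Q ^ Suc n) * fps_nth ?G (Suc n) = (1 - x * Q ^ n) * fps_nth ?G n"
      by (simp add: algebra_simps)
    then have "fps_nth ?G (Suc n) = (1 - x * Q ^ n) * fps_nth ?G n / (1 - Q ^ Suc n)"
      using one_minus_Q_power_nonzero[of n] by (metis nonzero_mult_div_cancel_left)
    then show ?case unfolding Suc.IH by (simp add: qf_Suc mult_ac)
  qed
  then show ?thesis by (simp add: nth)
qed

text \<open>The coefficients \<open>(-1)\<^sup>j q\<^bsup>j(j+1)/2\<^esup>\<close> of the Jacobi triple product
  \<open>(q, q u, 1/u; q)\<^sub>\<infinity>\<close>.\<close>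

definition theta_coeff :: "int \<Rightarrow> complex" where
  "theta_coeff j = (-1) powi j * of_real (q powr (of_int (j * (j + 1)) / 2))"

lemma theta_coeff_0 [simp]: "theta_coeff 0 = 1" and theta_coeff_m1 [simp]: "theta_coeff (-1) = -1"
  using q_pos by (simp_all add: theta_coeff_def power_int_minus)

lemma theta_coeff_Suc: "theta_coeff (j + 1) = - (Q powi (j + 1)) * theta_coeff j"
proof -
  have "q powr (of_int ((j + 1) * (j + 1 + 1)) / 2) = q powr (of_int (j + 1) + of_int (j * (j
      + 1)) / 2)"
    by (intro arg_cong[of _ _ "\<lambda>x. q powr x"]) (simp add: field_simps)
  also have "\<dots> = q powi (j + 1) * q powr (of_int (j * (j + 1)) / 2)"
    using q_pos by (subst powr_real_of_int'[symmetric]) (auto simp: powr_add)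
  finally have "q powr (of_int ((j + 1) * (j + 1 + 1)) / 2) = q powi (j + 1) * q powr (of_int (j
      * (j + 1)) / 2)" .
  then show ?thesis
    unfolding theta_coeff_def Q_def by (simp add: power_int_add)
qed

text \<open>From (k-m)(k-m+1)/2 = m(m-1)/2 + k(k-1)/2 + k(1-m). In this form sums of theta
  coefficients become instances of \<open>q_binomial\<close> with x = q^(1-m).\<close>

lemma theta_coeff_shift:
  "theta_coeff (int k - int m) = theta_coeff (- int m) * (euler_coeff k * qf k)
      * (Q powi (1 - int m)) ^ k"
proof (induction k)
  case (Suc k)
  have "theta_coeff (int (Suc k) - int m) = - (Q powi (int k - int m + 1))
      * theta_coeff (int k - int m)"
    using theta_coeff_Suc[of "int k - int m"] by (simp add: algebra_simps)
  also have "Q powi (int k - int m + 1) = Q ^ k * Q powi (1 - int m)"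
    using Q_nonzero power_int_add[of Q "int k" "1 - int m"] by (simp add: algebra_simps)
  also have "- (Q ^ k * Q powi (1 - int m)) * theta_coeff (int k - int m)
    = theta_coeff (- int m) * (- (Q ^ k) * euler_coeff k * qf k) * (Q powi (1 - int m)) ^ Suc k"
    unfolding Suc.IH by (simp add: mult_ac)
  also have "- (Q ^ k) * euler_coeff k * qf k = euler_coeff (Suc k) * qf (Suc k)"
    unfolding euler_coeff_Suc[symmetric] by (simp add: qf_Suc mult_ac)
  finally show ?case .
qed (simp add: euler_coeff_0)

text \<open>Each factor is reversed by (-q^k/u)(1 - u q^(-k)) = 1 - q^k/u; the extracted factors
  accumulate to the theta coefficient and the power of 1/u.\<close>

lemma finite_theta_half:
  assumes "u \<noteq> 0"
  shows "theta_coeff (- int N) * (1 / u) ^ N * (\<Prod>k<N. 1 - u * Q powi (- int k))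
      = (\<Prod>k<N. 1 - (1 / u) * Q ^ k)"
proof (induction N)
  case (Suc N)
  have "theta_coeff (- int N) = - (Q powi (- int N)) * theta_coeff (- int (Suc N))"
    using theta_coeff_Suc[of "- int (Suc N)"] by simp
  then have 1: "theta_coeff (- int (Suc N)) = - (Q ^ N) * theta_coeff (- int N)"
    using Q_nonzero by (simp add: power_int_minus field_simps)
  have 2: "- (Q ^ N) * (1 / u) * (1 - u * Q powi (- int N)) = 1 - (1 / u) * Q ^ N"
    using Q_nonzero assms by (simp add: power_int_minus field_simps)
  have "theta_coeff (- int (Suc N)) * (1 / u) ^ Suc N * (\<Prod>k<Suc N. 1 - u * Q powi (- int k))
    = (theta_coeff (- int N) * (1 / u) ^ N * (\<Prod>k<N. 1 - u * Q powi (- int k))) * (1 - (1 / u)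
        * Q ^ N)"
    unfolding 1 2[symmetric] prod.lessThan_Suc power_Suc
    by (simp only: mult_ac mult_minus_left mult_minus_right)
  then show ?case using Suc.IH by simp
qed simp

lemma prod_lessThan_add:
  "(\<Prod>k<m + n. g k) = (\<Prod>k<m. g k) * (\<Prod>k<n. g (m + k))" for g :: "nat \<Rightarrow> complex"
  by (induction n) (simp_all add: mult.assoc)

lemma finite_theta:
  assumes "u \<noteq> 0"
  shows "(\<Prod>k<N. 1 - (u * Q) * Q ^ k) * (\<Prod>k<N. 1 - (1 / u) * Q ^ k)
    = (\<Sum>i\<le>2 * N. qf (2 * N) / (qf i * qf (2 * N - i)) * theta_coeff (int i - int N)
        * u powi (int i - int N))"
proof -
  \<comment> \<open>This choice centres the product: for k < 2N the values \<open>?x * Q ^ k\<close>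
    run from u q^(1-N) to u q^N. The upper half is the product in u q, and the lower half is
    reversed into the product in 1/u.\<close>
  let ?x = "u * Q powi (1 - int N)"
  have a: "?x * Q ^ (N + k) = u * Q * Q ^ k" for k
    using Q_nonzero by (simp add: power_int_diff power_add field_simps)
  have b: "?x * Q ^ (N - Suc k) = u * Q powi (- int k)" if "k < N" for k
  proof -
    have "Q ^ (N - Suc k) = Q powi (int N - 1 - int k)"
      using that power_int_of_nat[of Q "N - Suc k"] by (simp add: of_nat_diff algebra_simps)
    then show ?thesis using Q_nonzero by (simp flip: power_int_add add: mult.assoc)
  qed
  have "(\<Prod>k<2 * N. 1 - ?x * Q ^ k) = (\<Prod>k<N + N. 1 - ?x * Q ^ k)"
    by (simp add: mult_2)
  also have "\<dots> = (\<Prod>k<N. 1 - ?x * Q ^ k) * (\<Prod>k<N. 1 - ?x * Q ^ (N + k))"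
    by (rule prod_lessThan_add)
  finally have "(\<Prod>k<2 * N. 1 - ?x * Q ^ k) = (\<Prod>k<N. 1 - ?x * Q ^ k) * (\<Prod>k<N. 1 - ?x * Q ^ (N
      + k))" .
  also have "(\<Prod>k<N. 1 - ?x * Q ^ k) = (\<Prod>k<N. 1 - ?x * Q ^ (N - Suc k))"
    by (rule prod.nat_diff_reindex[symmetric])
  also have "\<dots> = (\<Prod>k<N. 1 - u * Q powi (- int k))"
    using b by (intro prod.cong) auto
  finally have P: "(\<Prod>k<2 * N. 1 - ?x * Q ^ k)
      = (\<Prod>k<N. 1 - u * Q powi (- int k)) * (\<Prod>k<N. 1 - (u * Q) * Q ^ k)"
    by (simp add: a)
  have "(\<Prod>k<N. 1 - (u * Q) * Q ^ k) * (\<Prod>k<N. 1 - (1 / u) * Q ^ k)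
      = theta_coeff (- int N) * (1 / u) ^ N * (\<Prod>k<2 * N. 1 - ?x * Q ^ k)"
    unfolding P finite_theta_half[OF assms, symmetric] by (simp only: mult_ac)
  also have "\<dots> = theta_coeff (- int N) * (1 / u) ^ N * (qf (2 * N) * (\<Sum>k\<le>2 * N. euler_coeff k
      * ?x ^ k / qf (2 * N - k)))"
    by (simp add: q_binomial)
  also have "\<dots> = (\<Sum>i\<le>2 * N. qf (2 * N) / (qf i * qf (2 * N - i)) * theta_coeff (int i - int N)
      * u powi (int i - int N))"
    unfolding sum_distrib_left
    by (intro sum.cong refl)
       (use assms in \<open>simp add: theta_coeff_shift power_mult_distrib power_int_diff power_one_over
           divide_simps\<close>)
  finally show ?thesis .
qed

section \<open>Moments of the q-Hermite weight\<close>

definition M :: "real measure" where "M = restrict_space lborel {0..pi}"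

lemma space_M [simp]: "space M = {0..pi}"
  by (simp add: M_def space_restrict_space)

lemma measurable_M: "f \<in> borel_measurable borel \<Longrightarrow> f \<in> borel_measurable M"
  unfolding M_def by (intro measurable_restrict_space1) simp

lemma finite_measure_M: "finite_measure M"
  by (rule finite_measureI) (simp add: M_def space_restrict_space emeasure_restrict_space)

lemma integrable_M: "integrable M f \<longleftrightarrow> set_integrable lborel {0..pi} f"
  and integral_M: "integral\<^sup>L M f = set_lebesgue_integral lborel {0..pi} f" for f :: "real \<Rightarrow>
      complex"
  by (simp_all add: M_def integrable_restrict_space integral_restrict_space set_integrable_def
      set_lebesgue_integral_def)

lemma integrable_M_bounded:
  fixes f :: "real \<Rightarrow> complex"
  assumes "f \<in> borel_measurable borel" "\<And>x. norm (f x) \<le> B"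
  shows "integrable M f"
  using finite_measure_M assms(2)
  by (intro finite_measure.integrable_const_bound[where B = B] measurable_M assms(1)) auto

text \<open>On the half period [0, pi] only the even frequencies are orthogonal to constants. Odd
  degrees are therefore handled by a reflection instead.\<close>

lemma integral_M_cis: "integral\<^sup>L M (\<lambda>\<phi>. cis (2 * of_int j * \<phi>)) = (if j = 0 then pi else 0)"
proof (cases "j = 0")
  case True
  then show ?thesis
    by (simp add: M_def integral_restrict_space lebesgue_integral_const measure_restrict_space
        scaleR_conv_of_real)
next
  case False
  let ?F = "\<lambda>\<phi>::real. cis (2 * of_int j * \<phi>) / (2 * of_int j * \<i>)"
  have "(LINT \<phi>|lborel. indicator {0..pi} \<phi> *\<^sub>R cis (2 * of_int j * \<phi>)) = ?F pi - ?F 0"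
  proof (rule integral_FTC_Icc)
    fix \<phi> :: real
    have "((\<lambda>z. exp (\<i> * (2 * of_int j * z)) / (2 * of_int j * \<i>)) has_field_derivative
        exp (\<i> * (2 * of_int j * of_real \<phi>))) (at (of_real \<phi>))"
      using False by (auto intro!: derivative_eq_intros)
    from has_vector_derivative_real_field[OF this]
    show "(?F has_vector_derivative cis (2 * of_int j * \<phi>)) (at \<phi> within {0..pi})"
      by (simp add: cis_conv_exp)
  qed (auto intro!: continuous_intros)
  also have "\<dots> = 0"
    using cis_multiple_2pi[of "of_int j"] by (simp add: mult_ac)
  finally show ?thesis
    using False by (simp add: M_def integral_restrict_space)
qed

text \<open>The weight \<open>w_H(cos \<phi>) sin \<phi>\<close>, with the singularity at the end points removed.\<close>

definition weight :: "real \<Rightarrow> complex" where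
  "weight \<phi> = qpoch Q q * qpoch (cis (2 * \<phi>)) q * qpoch (1 / cis (2 * \<phi>)) q / (2 * pi)"

lemma measurable_qpoch [measurable]: "(\<lambda>A. qpoch A q) \<in> borel_measurable borel"
  by (intro borel_measurable_continuous_onI continuous_at_imp_continuous_on ballI
      field_differentiable_imp_continuous_at qpoch_field_differentiable)

lemma measurable_cis [measurable]: "cis \<in> borel_measurable borel"
  by (intro borel_measurable_continuous_onI) (auto intro!: continuous_intros)

lemma measurable_weight [measurable]: "weight \<in> borel_measurable borel"
  unfolding weight_def by measurable

lemma measurable_qherm [measurable]: "(\<lambda>\<phi>. qherm n (cis \<phi>)) \<in> borel_measurable borel"
  unfolding qherm_def by measurable

definition weight_bound :: real where "weight_bound = norm (qpoch Q q) * exp (1 / (1 - q))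
    * exp (1 / (1 - q))"

lemma norm_weight_le: "norm (weight \<phi>) \<le> weight_bound"
proof -
  have "norm (weight \<phi>) = norm (qpoch Q q) * norm (qpoch (cis (2 * \<phi>)) q)
      * norm (qpoch (1 / cis (2 * \<phi>)) q) / (2 * pi)"
    by (simp add: weight_def norm_mult norm_divide)
  also have "\<dots> \<le> norm (qpoch Q q) * norm (qpoch (cis (2 * \<phi>)) q) * norm (qpoch (1 / cis (2
      * \<phi>)) q) / 1"
    using pi_gt3 by (intro divide_left_mono) auto
  also have "\<dots> \<le> weight_bound"
    unfolding weight_bound_def div_by_1 by (intro mult_mono norm_qpoch_le order_refl) (auto simp:
        norm_divide)
  finally show ?thesis .
qed

lemma weight_bound_nonneg: "weight_bound \<ge> 0" by (simp add: weight_bound_def)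

lemma cis_double_powi: "cis (2 * \<phi>) powi j = cis (2 * of_int j * \<phi>)"
  by (simp add: cis_power_int mult_ac)

text \<open>Only the summand with i - N = -j survives; the bound on j keeps its index between 0 and
  2N.\<close>

lemma finite_moment:
  fixes C :: "nat \<Rightarrow> complex"
  assumes "\<bar>j\<bar> \<le> int N"
  shows "integral\<^sup>L M (\<lambda>\<phi>. cis (2 * \<phi>) powi j * (\<Sum>i\<le>2 * N. C i * cis (2 * \<phi>) powi (int i - int N)))
    = pi * C (nat (int N - j))"
proof -
  have *: "cis (2 * \<phi>) powi j * (\<Sum>i\<le>2 * N. C i * cis (2 * \<phi>) powi (int i - int N))
     = (\<Sum>i\<le>2 * N. C i * cis (2 * of_int (j + (int i - int N)) * \<phi>))" for \<phi>
  proof -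
    have "cis (2 * \<phi>) powi j * (C i * cis (2 * \<phi>) powi (int i - int N))
        = C i * cis (2 * of_int (j + (int i - int N)) * \<phi>)" for i
      unfolding cis_double_powi[symmetric] by (simp add: power_int_add)
    then show ?thesis by (simp only: sum_distrib_left)
  qed
  have int: "integrable M (\<lambda>\<phi>. C i * cis (2 * of_int l * \<phi>))" for i l
    by (rule integrable_M_bounded[where B = "norm (C i)"]) (auto simp: norm_mult)
  have "integral\<^sup>L M (\<lambda>\<phi>. \<Sum>i\<le>2 * N. C i * cis (2 * of_int (j + (int i - int N)) * \<phi>))
     = (\<Sum>i\<le>2 * N. C i * (if j + (int i - int N) = 0 then pi else 0))"
    by (subst Bochner_Integration.integral_sum[OF int]) (simp add: integral_M_cis del: of_int_add
        of_int_diff)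
  also have "\<dots> = (\<Sum>i\<le>2 * N. if i = nat (int N - j) then C i * pi else 0)"
    using assms by (intro sum.cong) (auto split: if_splits)
  also have "\<dots> = C (nat (int N - j)) * pi"
    using assms by (subst sum.delta) auto
  finally show ?thesis unfolding * by (simp add: mult.commute)
qed

text \<open>With u = exp(2 i phi), (u;q)_infinity = (1 - u)(q u;q)_infinity, so the triple product
  contributes two neighbouring theta coefficients. The limit is taken under the integral of the
  truncated products, dominated by a constant.\<close>

lemma moment_weight:
  "integral\<^sup>L M (\<lambda>\<phi>. cis (2 * \<phi>) powi j * weight \<phi>) = (theta_coeff (- j) - theta_coeff (- j - 1))
      / 2"
proof -
  let ?u = "\<lambda>\<phi>. cis (2 * \<phi>)"
  define C where "C N i = qf (2 * N) / (qf i * qf (2 * N - i))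
      * theta_coeff (int i - int N)" for N i :: nat
  define T where "T N \<phi> = (\<Prod>k<N. 1 - (?u \<phi> * Q) * Q ^ k) * (\<Prod>k<N. 1 - (1 / ?u \<phi>) * Q ^ k)" for N \<phi>
  \<comment> \<open>The product in u has one factor more than the product in 1/u: splitting off 1 -
    u leaves exactly the symmetric product \<open>T N\<close>.\<close>
  define w where "w N \<phi> = qpoch Q q * (\<Prod>k<Suc N. 1 - ?u \<phi> * Q ^ k) * (\<Prod>k<N. 1 - (1 / ?u \<phi>)
      * Q ^ k) / (2 * pi)" for N \<phi>
  have wT: "w N \<phi> = qpoch Q q / (2 * pi) * ((1 - ?u \<phi>) * T N \<phi>)" for N \<phi>
    unfolding w_def T_def prod.lessThan_Suc_shift by (simp add: mult_ac)
  have T: "T N \<phi> = (\<Sum>i\<le>2 * N. C N i * ?u \<phi> powi (int i - int N))" for N \<phi>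
    unfolding T_def C_def by (rule finite_theta) simp
  have Tm [measurable]: "T N \<in> borel_measurable borel" for N
    unfolding T_def by measurable
  have um [measurable]: "(\<lambda>\<phi>. ?u \<phi> powi i) \<in> borel_measurable borel" for i
    unfolding cis_double_powi by measurable
  have Tb: "norm (T N \<phi>) \<le> exp (1 / (1 - q)) * exp (1 / (1 - q))" for N \<phi>
    unfolding T_def norm_mult using q_pos q_less_1
    by (intro mult_mono norm_qpoch_partial_le) (auto simp: norm_mult norm_divide Q_norm)
  have nu: "norm (?u \<phi> powi i) = 1" for \<phi> i
    unfolding cis_double_powi by simp
  have int: "integrable M (\<lambda>\<phi>. ?u \<phi> powi i * T N \<phi>)" for i N
    using Tb by (intro integrable_M_bounded) (auto simp: norm_mult nu)
  have c: "integral\<^sup>L M (\<lambda>\<phi>. ?u \<phi> powi j * w N \<phi>)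
      = qpoch Q q / 2 * (C N (nat (int N - j)) - C N (nat (int N - (j + 1))))"
    if "int N \<ge> \<bar>j\<bar> + 1" for N
  proof -
    have "integral\<^sup>L M (\<lambda>\<phi>. ?u \<phi> powi j * w N \<phi>)
      = integral\<^sup>L M (\<lambda>\<phi>. qpoch Q q / (2 * pi) * (?u \<phi> powi j * T N \<phi> - ?u \<phi> powi (j + 1) * T N \<phi>))"
      by (intro Bochner_Integration.integral_cong refl) (simp add: wT power_int_add algebra_simps)
    also have "\<dots> = qpoch Q q / (2 * pi) * (integral\<^sup>L M (\<lambda>\<phi>. ?u \<phi> powi j
        * T N \<phi>) - integral\<^sup>L M (\<lambda>\<phi>. ?u \<phi> powi (j + 1) * T N \<phi>))"
      by (subst integral_mult_right_zero) (simp add: Bochner_Integration.integral_diff int)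
    also have "integral\<^sup>L M (\<lambda>\<phi>. ?u \<phi> powi j * T N \<phi>) = pi * C N (nat (int N - j))"
      unfolding T by (rule finite_moment) (use that in auto)
    also have "integral\<^sup>L M (\<lambda>\<phi>. ?u \<phi> powi (j + 1) * T N \<phi>) = pi * C N (nat (int N - (j + 1)))"
      unfolding T by (rule finite_moment) (use that in auto)
    finally show ?thesis unfolding right_diff_distrib[symmetric] by simp
  qed
  have lim_nat: "filterlim (\<lambda>N. nat (int N + l)) sequentially sequentially" for l
    unfolding filterlim_at_top
  proof
    fix Z :: nat
    show "\<forall>\<^sub>F N in sequentially. Z \<le> nat (int N + l)"
      using eventually_ge_at_top[of "Z + nat \<bar>l\<bar>"] by eventually_elim linarith
  qed
  \<comment> \<open>Both indices N - l and N + l tend to infinity, so the q-binomial coefficient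
    tends to 1/(q;q)_infinity. This cancels the factor (q;q)_infinity of the weight.\<close>
  have Clim: "(\<lambda>N. C N (nat (int N - l))) \<longlonglongrightarrow> qpoch Q q / (qpoch Q q * qpoch Q q)
      * theta_coeff (- l)" for l
  proof -
    have "(\<lambda>N. qf (2 * N) / (qf (nat (int N + - l)) * qf (nat (int N + l))) * theta_coeff (- l))
      \<longlonglongrightarrow> qpoch Q q / (qpoch Q q * qpoch Q q) * theta_coeff (- l)"
      by (intro tendsto_intros filterlim_compose[OF qf_LIMSEQ] lim_nat filterlim_subseq
          strict_monoI)
        (auto simp: qpoch_Q_nonzero)
    moreover have "\<forall>\<^sub>F N in sequentially. qf (2 * N) / (qf (nat (int N + - l)) * qf (nat (int N
        + l))) * theta_coeff (- l)
       = C N (nat (int N - l))"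
      using eventually_ge_at_top[of "nat \<bar>l\<bar>"]
    proof eventually_elim
      case (elim N)
      then have "2 * N - nat (int N - l) = nat (int N + l)" "int (nat (int N - l)) - int N = - l"
        by auto
      then show ?case by (simp add: C_def)
    qed
    ultimately show ?thesis by (rule Lim_transform_eventually)
  qed
  have "(\<lambda>N. integral\<^sup>L M (\<lambda>\<phi>. ?u \<phi> powi j * w N \<phi>)) \<longlonglongrightarrow> integral\<^sup>L M (\<lambda>\<phi>. ?u \<phi> powi j * weight \<phi>)"
  proof (rule integral_dominated_convergence[where w = "\<lambda>_. norm (qpoch Q q) * exp (1 / (1 - q))
      * exp (1 / (1 - q))"])
    show "AE \<phi> in M. (\<lambda>N. ?u \<phi> powi j * w N \<phi>) \<longlonglongrightarrow> ?u \<phi> powi j * weight \<phi>"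
      unfolding w_def weight_def
      by (intro AE_I2 tendsto_intros LIMSEQ_Suc[OF qpoch_LIMSEQ] qpoch_LIMSEQ) auto
    show "AE \<phi> in M. norm (?u \<phi> powi j * w N \<phi>) \<le> norm (qpoch Q q) * exp (1 / (1 - q))
        * exp (1 / (1 - q))" for N
    proof (rule AE_I2)
      fix \<phi>
      have "norm (w N \<phi>) = norm (qpoch Q q) * norm (\<Prod>k<Suc N. 1 - ?u \<phi> * Q ^ k)
          * norm (\<Prod>k<N. 1 - (1 / ?u \<phi>) * Q ^ k) / (2 * pi)"
        unfolding w_def by (simp only: norm_mult norm_divide) simp
      also have "\<dots> \<le> norm (qpoch Q q) * norm (\<Prod>k<Suc N. 1 - ?u \<phi> * Q ^ k)
          * norm (\<Prod>k<N. 1 - (1 / ?u \<phi>) * Q ^ k) / 1"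
        using pi_gt3 by (intro divide_left_mono) auto
      also have "\<dots> \<le> norm (qpoch Q q) * exp (1 / (1 - q)) * exp (1 / (1 - q))"
        unfolding div_by_1 by (intro mult_mono norm_qpoch_partial_le order_refl) (auto simp:
            norm_divide)
      finally show "norm (?u \<phi> powi j * w N \<phi>) \<le> norm (qpoch Q q) * exp (1 / (1 - q))
          * exp (1 / (1 - q))"
        by (simp add: norm_mult nu)
    qed
    show "(\<lambda>\<phi>. ?u \<phi> powi j * weight \<phi>) \<in> borel_measurable M"
      by (intro measurable_M) measurable
    show "(\<lambda>\<phi>. ?u \<phi> powi j * w N \<phi>) \<in> borel_measurable M" for N
      unfolding wT by (intro measurable_M) measurable
    show "integrable M (\<lambda>_. norm (qpoch Q q) * exp (1 / (1 - q)) * exp (1 / (1 - q)))"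
      by (rule finite_measure.integrable_const[OF finite_measure_M])
  qed
  moreover have "(\<lambda>N. integral\<^sup>L M (\<lambda>\<phi>. ?u \<phi> powi j * w N \<phi>)) \<longlonglongrightarrow>
     qpoch Q q / 2 * (qpoch Q q / (qpoch Q q * qpoch Q q) * theta_coeff (- j)
       - qpoch Q q / (qpoch Q q * qpoch Q q) * theta_coeff (- (j + 1)))"
  proof (rule Lim_transform_eventually)
    show "(\<lambda>N. qpoch Q q / 2 * (C N (nat (int N - j)) - C N (nat (int N - (j + 1))))) \<longlonglongrightarrow>
     qpoch Q q / 2 * (qpoch Q q / (qpoch Q q * qpoch Q q) * theta_coeff (- j)
       - qpoch Q q / (qpoch Q q * qpoch Q q) * theta_coeff (- (j + 1)))"
      by (intro tendsto_mult tendsto_diff Clim tendsto_const)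
    show "\<forall>\<^sub>F N in sequentially. qpoch Q q / 2 * (C N (nat (int N - j)) - C N (nat (int N - (j
        + 1))))
       = integral\<^sup>L M (\<lambda>\<phi>. ?u \<phi> powi j * w N \<phi>)"
      using eventually_ge_at_top[of "nat (\<bar>j\<bar> + 1)"] by eventually_elim (simp add: c)
  qed
  ultimately have "integral\<^sup>L M (\<lambda>\<phi>. ?u \<phi> powi j * weight \<phi>)
    = qpoch Q q / 2 * (qpoch Q q / (qpoch Q q * qpoch Q q) * theta_coeff (- j)
       - qpoch Q q / (qpoch Q q * qpoch Q q) * theta_coeff (- (j + 1)))"
    by (rule LIMSEQ_unique)
  moreover have "p / 2 * (p / (p * p) * a - p / (p * p) * b)
      = (a - b) / 2" if "p \<noteq> 0" for p a b :: complex
    using that by (simp add: field_simps)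
  moreover have "- (j + 1) = - j - 1" by simp
  ultimately show ?thesis using qpoch_Q_nonzero by simp
qed

section \<open>Orthogonality relations from the moments\<close>

lemma qherm_even:
  assumes "norm z = 1"
  shows "qherm (2 * m) z = (\<Sum>k\<le>2 * m. 1 / (qf k * qf (2 * m - k)) * (z ^ 2) powi (int k - int m))"
  unfolding qherm_def
proof (intro sum.cong refl)
  fix k assume "k \<in> {..2 * m}"
  have "z \<noteq> 0" using assms by auto
  \<comment> \<open>In even degree the exponent k - (2m - k) = 2(k - m) is even, so only powers of
    z^2 occur, and those have known moments.\<close>
  have "z ^ k * (1 / z) ^ (2 * m - k) = z powi int k * z powi (- int (2 * m - k))"
    by (simp add: power_int_minus power_one_over divide_simps)
  also have "\<dots> = z powi (int k + - int (2 * m - k))"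
    using \<open>z \<noteq> 0\<close> power_int_add[of z "int k" "- int (2 * m - k)"] by simp
  also have "int k + - int (2 * m - k) = 2 * (int k - int m)"
    using \<open>k \<in> _\<close> by (simp add: of_nat_diff)
  also have "z powi (2 * (int k - int m)) = (z ^ 2) powi (int k - int m)"
    using power_int_mult[of z 2 "int k - int m"] by simp
  finally show "z ^ k / qf k * ((1 / z) ^ (2 * m - k) / qf (2 * m - k)) = 1 / (qf k * qf (2
      * m - k)) * (z ^ 2) powi (int k - int m)"
    by (simp add: mult_ac)
qed

lemma integrable_qherm_weight: "integrable M (\<lambda>\<phi>. qherm m (cis \<phi>) * qherm n (cis \<phi>) * weight \<phi>)"
proof (rule integrable_M_bounded)
  fix \<phi>
  have "norm (qherm m (cis \<phi>) * qherm n (cis \<phi>) * weight \<phi>) \<le> (qherm_bound * (real m + 1))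
      * (qherm_bound * (real n + 1)) * weight_bound"
    unfolding norm_mult using qherm_bound_nonneg
    by (intro mult_mono norm_qherm_le norm_weight_le) auto
  then show "norm (qherm m (cis \<phi>) * qherm n (cis \<phi>) * weight \<phi>) \<le> (qherm_bound * (real m + 1))
      * (qherm_bound * (real n + 1)) * weight_bound" .
qed measurable

text \<open>By \<open>q_binomial\<close> the sum is a multiple of the product of 1 - q^(1-l+k) over
  k < 2m, whose factor k = l - 1 vanishes.\<close>

lemma sum_theta_zero:
  assumes "l \<ge> 1" "l \<le> 2 * m"
  shows "(\<Sum>k\<le>2 * m. 1 / (qf k * qf (2 * m - k)) * theta_coeff (int k - int l)) = 0"
proof -
  let ?x = "Q powi (1 - int l)"
  have "(\<Sum>k\<le>2 * m. 1 / (qf k * qf (2 * m - k)) * theta_coeff (int k - int l))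
    = theta_coeff (- int l) * (\<Sum>k\<le>2 * m. euler_coeff k * ?x ^ k / qf (2 * m - k))"
    unfolding theta_coeff_shift sum_distrib_left by (intro sum.cong refl) simp
  also have "(\<Sum>k\<le>2 * m. euler_coeff k * ?x ^ k / qf (2 * m - k)) = (\<Prod>k<2 * m. 1 - ?x
      * Q ^ k) / qf (2 * m)"
    by (rule q_binomial)
  also have "(\<Prod>k<2 * m. 1 - ?x * Q ^ k) = 0"
  proof (rule prod_zero)
    have "?x * Q ^ (l - 1) = Q powi (1 - int l) * Q powi (int (l - 1))" by simp
    also have "\<dots> = 1"
      using Q_nonzero assms by (simp flip: power_int_add add: of_nat_diff)
    finally show "\<exists>k\<in>{..<2 * m}. 1 - ?x * Q ^ k = 0"
      using assms by (intro bexI[of _ "l - 1"]) auto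
  qed simp
  finally show ?thesis by simp
qed

lemma integral_qherm_even: "integral\<^sup>L M (\<lambda>\<phi>. qherm (2 * m) (cis \<phi>) * weight \<phi>) = (if m
    = 0 then 1 else 0)"
proof -
  let ?b = "\<lambda>k. 1 / (qf k * qf (2 * m - k))"
  have int: "integrable M (\<lambda>\<phi>. ?b k * (cis (2 * \<phi>) powi j * weight \<phi>))" for k j
  proof (rule integrable_M_bounded)
    show "(\<lambda>\<phi>. ?b k * (cis (2 * \<phi>) powi j * weight \<phi>)) \<in> borel_measurable borel"
      unfolding cis_double_powi by measurable
    show "norm (?b k * (cis (2 * \<phi>) powi j * weight \<phi>)) \<le> norm (?b k) * weight_bound" for \<phi>
      unfolding norm_mult cis_double_powi norm_cis mult_1 by (intro mult_left_mono norm_weight_le)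
          auto
  qed
  have "cis \<phi> ^ 2 = cis (2 * \<phi>)" for \<phi>
    by (simp add: power2_eq_square cis_mult)
  then have "qherm (2 * m) (cis \<phi>) * weight \<phi> = (\<Sum>k\<le>2 * m. ?b k * (cis (2
      * \<phi>) powi (int k - int m) * weight \<phi>))" for \<phi>
    by (subst qherm_even) (simp_all add: sum_distrib_right mult.assoc)
  then have "integral\<^sup>L M (\<lambda>\<phi>. qherm (2 * m) (cis \<phi>) * weight \<phi>)
     = (\<Sum>k\<le>2 * m. integral\<^sup>L M (\<lambda>\<phi>. ?b k * (cis (2 * \<phi>) powi (int k - int m) * weight \<phi>)))"
    by (simp only: Bochner_Integration.integral_sum[OF int])
  also have "\<dots> = (\<Sum>k\<le>2 * m. ?b k * ((theta_coeff (int m - int k) - theta_coeff (int m - int k -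
      1)) / 2))"
    by (simp only: integral_mult_right_zero moment_weight minus_diff_eq)
  \<comment> \<open>Reversing the summation fixes the symmetric coefficient \<open>?b\<close> and
    brings the theta coefficients into the form of \<open>sum_theta_zero\<close>.\<close>
  also have "\<dots> = (\<Sum>k\<le>2 * m. ?b k * ((theta_coeff (int k - int m) - theta_coeff (int k - int m -
      1)) / 2))"
    by (rule sum.reindex_bij_witness[of _ "\<lambda>k. 2 * m - k" "\<lambda>k. 2 * m - k"])
       (auto simp: of_nat_diff mult.commute)
  also have "\<dots> = (if m = 0 then 1 else 0)"
  proof (cases "m = 0")
    case False
    have "(\<Sum>k\<le>2 * m. ?b k * ((theta_coeff (int k - int m) - theta_coeff (int k - int m - 1)) / 2))
      = ((\<Sum>k\<le>2 * m. ?b k * theta_coeff (int k - int m)) - (\<Sum>k\<le>2 * m. ?b k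
          * theta_coeff (int k - int (Suc m)))) / 2"
      by (simp add: sum_subtractf[symmetric] sum_divide_distrib algebra_simps diff_divide_distrib)
    \<comment> \<open>The two sums have l = m and l = m + 1; both lie in 1..2m exactly because m >=
      1. For m = 0 the single term is (1 - (-1))/2 = 1.\<close>
    then show ?thesis
      using False sum_theta_zero[of m m] sum_theta_zero[of "Suc m" m] by simp
  qed simp
  finally show ?thesis .
qed

lemma integral_M_reflect: "integral\<^sup>L M (\<lambda>\<phi>. g (pi - \<phi>)) = integral\<^sup>L M g" for g :: "real \<Rightarrow> complex"
proof -
  have "integral\<^sup>L M g = (LINT \<phi>|lborel. indicator {0..pi} \<phi> *\<^sub>R g \<phi>)"
    by (simp add: M_def integral_restrict_space)
  also have "\<dots> = (LINT \<phi>|lborel. indicator {0..pi} (pi + (-1) * \<phi>) *\<^sub>R g (pi + (-1) * \<phi>))"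
    using lborel_integral_real_affine[of "-1" "\<lambda>\<phi>. indicator {0..pi} \<phi> *\<^sub>R g \<phi>" pi] by simp
  also have "\<dots> = (LINT \<phi>|lborel. indicator {0..pi} \<phi> *\<^sub>R g (pi - \<phi>))"
    by (intro Bochner_Integration.integral_cong refl) (auto simp: indicator_def)
  also have "\<dots> = integral\<^sup>L M (\<lambda>\<phi>. g (pi - \<phi>))"
    by (simp add: M_def integral_restrict_space)
  finally show ?thesis by simp
qed

lemma qherm_minus: "qherm n (- z) = (-1) ^ n * qherm n z"
proof -
  have "(- z) ^ k * (1 / (- z)) ^ (n - k) = (-1) ^ n * (z ^ k * (1 / z) ^ (n - k))" if "k \<le> n" for k
  proof -
    have "(-1::complex) ^ n = (-1) ^ k * (-1) ^ (n - k)"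
      using that by (simp flip: power_add)
    then show ?thesis
      by (simp add: power_minus[of z] power_minus[of "1 / z"])
  qed
  then show ?thesis
    unfolding qherm_def sum_distrib_left by (intro sum.cong refl) (simp add: mult_ac)
qed

lemma qherm_inverse: "qherm n (1 / z) = qherm n z"
  unfolding qherm_def
  by (rule sum.reindex_bij_witness[of _ "\<lambda>k. n - k" "\<lambda>k. n - k"]) (auto simp: mult_ac)

lemma weight_reflect: "weight (pi - \<phi>) = weight \<phi>"
proof -
  have "cis (2 * (pi - \<phi>)) = 1 / cis (2 * \<phi>)"
    using cis_divide[of "2 * pi" "2 * \<phi>"] by (simp add: right_diff_distrib)
  then show ?thesis by (simp add: weight_def mult_ac)
qed

text \<open>The reflection phi -> pi - phi sends z to -1/z: it preserves the weight and changes the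
  sign of an odd-degree polynomial.\<close>

lemma integral_qherm_odd:
  assumes "odd n" shows "integral\<^sup>L M (\<lambda>\<phi>. qherm n (cis \<phi>) * weight \<phi>) = 0"
proof -
  have "cis (pi - \<phi>) = - (1 / cis \<phi>)" for \<phi>
    by (simp add: cis_divide[symmetric])
  then have "qherm n (cis (pi - \<phi>)) * weight (pi - \<phi>) = - (qherm n (cis \<phi>) * weight \<phi>)" for \<phi>
    using assms by (simp only: qherm_minus qherm_inverse weight_reflect) simp
  then have "integral\<^sup>L M (\<lambda>\<phi>. qherm n (cis \<phi>) * weight \<phi>) = - integral\<^sup>L M (\<lambda>\<phi>. qherm n (cis \<phi>)
      * weight \<phi>)"
    using integral_M_reflect[of "\<lambda>\<phi>. qherm n (cis \<phi>) * weight \<phi>"] by simp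
  then show ?thesis by simp
qed

lemma integral_qherm_weight: "integral\<^sup>L M (\<lambda>\<phi>. qherm n (cis \<phi>) * weight \<phi>) = (if n
    = 0 then 1 else 0)"
proof (cases "even n")
  case True
  then obtain m where "n = 2 * m" by (elim evenE)
  then show ?thesis using integral_qherm_even[of m] by simp
next
  case False
  then show ?thesis using integral_qherm_odd[of n] odd_pos[of n] by auto
qed

definition gram :: "nat \<Rightarrow> nat \<Rightarrow> complex" where
  "gram m n = integral\<^sup>L M (\<lambda>\<phi>. qherm m (cis \<phi>) * qherm n (cis \<phi>) * weight \<phi>)"

lemma gram_commute: "gram m n = gram n m"
  by (simp add: gram_def mult_ac)

lemma gram_0: "gram 0 n = (if n = 0 then 1 else 0)"
  by (simp add: gram_def integral_qherm_weight)

lemma X_qherm: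
  assumes "z \<noteq> 0"
  shows "(z + 1 / z) * qherm n z = (1 - Q ^ Suc n) * qherm (Suc n) z + (if n
      = 0 then 0 else qherm (n - 1) z)"
  using assms qherm_Suc_0[of z] qherm_Suc_Suc[of z "n - 1"] by (cases n) auto

text \<open>Multiplication by z + 1/z may be moved from one polynomial to the other under the
  integral; both sides are then expanded by the three-term recurrence.\<close>

lemma gram_shift:
  "(1 - Q ^ Suc m) * gram (Suc m) n + (if m = 0 then 0 else gram (m - 1) n)
    = (1 - Q ^ Suc n) * gram m (Suc n) + (if n = 0 then 0 else gram m (n - 1))"
proof -
  have L: "(1 - Q ^ Suc m) * gram (Suc m) n + (if m = 0 then 0 else gram (m - 1) n)
    = integral\<^sup>L M (\<lambda>\<phi>. (cis \<phi> + 1 / cis \<phi>) * qherm m (cis \<phi>) * qherm n (cis \<phi>) * weight \<phi>)" for m n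
  proof -
    have "integral\<^sup>L M (\<lambda>\<phi>. (cis \<phi> + 1 / cis \<phi>) * qherm m (cis \<phi>) * qherm n (cis \<phi>) * weight \<phi>)
      = integral\<^sup>L M (\<lambda>\<phi>. (1 - Q ^ Suc m) * (qherm (Suc m) (cis \<phi>) * qherm n (cis \<phi>) * weight \<phi>)
         + (if m = 0 then 0 else 1) * (qherm (m - 1) (cis \<phi>) * qherm n (cis \<phi>) * weight \<phi>))"
      by (intro Bochner_Integration.integral_cong refl, subst X_qherm) (auto simp: algebra_simps)
    also have "\<dots> = (1 - Q ^ Suc m) * gram (Suc m) n + (if m = 0 then 0 else 1) * gram (m - 1) n"
      unfolding gram_def
      by (subst Bochner_Integration.integral_add)
         (auto intro!: integrable_qherm_weight integrable_mult_right simp del: power_Suc)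
    finally show ?thesis by simp
  qed
  have "(1 - Q ^ Suc m) * gram (Suc m) n + (if m = 0 then 0 else gram (m - 1) n)
    = (1 - Q ^ Suc n) * gram (Suc n) m + (if n = 0 then 0 else gram (n - 1) m)"
    unfolding L by (simp add: mult_ac)
  then show ?thesis by (simp only: gram_commute[of _ m])
qed

text \<open>\<open>gram_shift\<close> determines row k + 1 from rows k and k - 1, so row 0, that is
  the integrals of single polynomials, suffices to start the induction.\<close>

lemma gram_eq: "gram m n = (if m = n then 1 / qf n else 0)"
proof (induction m arbitrary: n rule: less_induct)
  case (less m)
  show ?case
  proof (cases m)
    case 0
    then show ?thesis by (simp add: gram_0)
  next
    case (Suc k)
    show ?thesis
    proof (cases n)
      case 0
      then show ?thesis using Suc gram_0[of m] gram_commute[of m 0] by simp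
    next
      case (Suc l)
      have IH: "gram k j = (if k = j then 1 / qf j else 0)" for j
        using less \<open>m = Suc k\<close> by simp
      have IH': "gram (k - 1) j = (if k - 1 = j then 1 / qf j else 0)" for j
        using less[of "k - 1"] \<open>m = Suc k\<close> by simp
      \<comment> \<open>The contributions of \<open>gram k (Suc n)\<close> and
        \<open>gram (k - 1) n\<close> are equal, nonzero only for k = n + 1, and cancel. Only
        \<open>gram k l\<close> with n = l + 1 remains.\<close>
      have A: "(1 - Q ^ Suc n) * gram k (Suc n) = (if k = Suc n then 1 / qf n else 0)"
        using one_minus_Q_power_nonzero[of n] by (simp add: IH qf_Suc del: power_Suc)
      have B: "(if k = 0 then 0 else gram (k - 1) n) = (if k = Suc n then 1 / qf n else 0)"
        using IH'[of n] by (cases k) auto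
      have "(1 - Q ^ Suc k) * gram m n = (if k = l then 1 / qf k else 0)"
        using gram_shift[of k n, unfolded A B] \<open>m = Suc k\<close> Suc by (simp add: IH del: power_Suc)
      then have "gram m n = (if k = l then 1 / qf k else 0) / (1 - Q ^ Suc k)"
        using one_minus_Q_power_nonzero[of k] by (metis nonzero_mult_div_cancel_left)
      then show ?thesis
        using \<open>m = Suc k\<close> Suc by (simp add: qf_Suc del: power_Suc)
    qed
  qed
qed

section \<open>The integral operators\<close>

text \<open>F is meant to contain the orthogonality weight already, as \<open>K_integrand\<close>
  does; hence there is no weight in the integral.\<close>

definition qherm_coeff :: "(real \<Rightarrow> complex) \<Rightarrow> nat \<Rightarrow> complex" where
  "qherm_coeff F n = integral\<^sup>L M (\<lambda>\<phi>. qherm n (cis \<phi>) * F \<phi>)"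

definition op_series :: "(real \<Rightarrow> complex) \<Rightarrow> complex \<Rightarrow> complex \<Rightarrow> complex" where
  "op_series F z r = (\<Sum>n. qf n * qherm n z * qherm_coeff F n * r ^ n)"

lemma integrable_bounded_mult:
  fixes F g :: "real \<Rightarrow> complex"
  assumes "integrable M F" "g \<in> borel_measurable borel" "\<And>\<phi>. norm (g \<phi>) \<le> B"
  shows "integrable M (\<lambda>\<phi>. g \<phi> * F \<phi>)"
proof (rule Bochner_Integration.integrable_bound[where f = "\<lambda>\<phi>. B * norm (F \<phi>)"])
  show "integrable M (\<lambda>\<phi>. B * norm (F \<phi>))" using assms(1) by simp
  show "(\<lambda>\<phi>. g \<phi> * F \<phi>) \<in> borel_measurable M"
    by (intro borel_measurable_times measurable_M[OF assms(2)] borel_measurable_integrable[OF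
        assms(1)])
  show "AE \<phi> in M. norm (g \<phi> * F \<phi>) \<le> norm (B * norm (F \<phi>))"
  proof (rule AE_I2)
    fix \<phi>
    have "norm (g \<phi>) * norm (F \<phi>) \<le> B * norm (F \<phi>)"
      by (intro mult_right_mono assms) auto
    moreover have "B \<ge> 0" using assms(3)[of 0] norm_ge_zero order_trans by blast
    ultimately show "norm (g \<phi> * F \<phi>) \<le> norm (B * norm (F \<phi>))" by (simp add: norm_mult)
  qed
qed

lemma integrable_qherm_mult: "integrable M F \<Longrightarrow> integrable M (\<lambda>\<phi>. qherm n (cis \<phi>) * F \<phi>)"
  by (rule integrable_bounded_mult[where B = "qherm_bound * (real n
      + 1)"]) (auto intro: norm_qherm_le)

lemma norm_qherm_coeff_le:
  assumes "integrable M F"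
  shows "norm (qherm_coeff F n) \<le> qherm_bound * (real n + 1) * integral\<^sup>L M (\<lambda>\<phi>. norm (F \<phi>))"
proof -
  have "norm (qherm_coeff F n) \<le> integral\<^sup>L M (\<lambda>\<phi>. norm (qherm n (cis \<phi>) * F \<phi>))"
    unfolding qherm_coeff_def by (rule integral_norm_bound)
  also have "\<dots> \<le> integral\<^sup>L M (\<lambda>\<phi>. qherm_bound * (real n + 1) * norm (F \<phi>))"
  proof (rule integral_mono)
    show "integrable M (\<lambda>\<phi>. norm (qherm n (cis \<phi>) * F \<phi>))"
      by (rule integrable_norm[OF integrable_qherm_mult[OF assms]])
    show "integrable M (\<lambda>\<phi>. qherm_bound * (real n + 1) * norm (F \<phi>))" using assms by simp
    show "norm (qherm n (cis \<phi>) * F \<phi>) \<le> qherm_bound * (real n + 1) * norm (F \<phi>)" for \<phi>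
      unfolding norm_mult by (intro mult_right_mono norm_qherm_le) auto
  qed
  finally show ?thesis by simp
qed

lemma summable_op_series:
  assumes "integrable M F" "norm z = 1" "norm r < 1"
  shows "summable (\<lambda>n. norm (qf n * qherm n z * qherm_coeff F n * r ^ n))"
proof (rule summable_comparison_test')
  let ?I = "integral\<^sup>L M (\<lambda>\<phi>. norm (F \<phi>))"
  show "summable (\<lambda>n. poisson_coeff_bound * ?I * ((real n + 1) ^ 2 * norm r ^ n))"
    using assms by (intro summable_mult summable_poly_geometric) auto
  fix n
  have "norm (qf n * qherm n z * qherm_coeff F n) \<le> exp (1 / (1 - q)) * (qherm_bound * (real n
      + 1)) * (qherm_bound * (real n + 1) * ?I)"
    unfolding norm_mult using assms qherm_bound_nonneg
    by (intro mult_mono norm_qf_le norm_qherm_le norm_qherm_coeff_le) auto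
  also have "\<dots> = poisson_coeff_bound * ?I * (real n + 1) ^ 2"
    by (simp add: poisson_coeff_bound_def power2_eq_square mult_ac)
  finally have "norm (qf n * qherm n z * qherm_coeff F n) * norm r ^ n \<le> poisson_coeff_bound * ?I
      * (real n + 1) ^ 2 * norm r ^ n"
    by (intro mult_right_mono) auto
  then show "norm (norm (qf n * qherm n z * qherm_coeff F n * r ^ n)) \<le> poisson_coeff_bound * ?I
      * ((real n + 1) ^ 2 * norm r ^ n)"
    by (simp add: norm_mult norm_power mult.assoc)
qed

lemma op_series_field_differentiable:
  assumes "integrable M F" "norm z = 1" "norm r < 1"
  shows "op_series F z field_differentiable at r"
proof -
  \<comment> \<open>An intermediate radius: the series converges at s, hence may be differentiated
    termwise at every point of smaller modulus.\<close>
  obtain s where s: "norm r < s" "s < 1" using assms dense by blast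
  have "summable (\<lambda>n. qf n * qherm n z * qherm_coeff F n * (of_real s) ^ n)"
  proof (intro summable_norm_cancel[OF summable_op_series] assms)
    show "norm (of_real s :: complex) < 1" using s norm_ge_zero[of r] by (simp del: norm_ge_zero)
  qed
  from termdiffs_strong[OF this] have "((\<lambda>r. \<Sum>n. qf n * qherm n z * qherm_coeff F n
      * r ^ n) has_field_derivative
     (\<Sum>n. diffs (\<lambda>n. qf n * qherm n z * qherm_coeff F n) n * r ^ n)) (at r)"
    using s by auto
  then show ?thesis unfolding op_series_def field_differentiable_def by blast
qed

lemma measurable_poisson_coeff [measurable]: "(\<lambda>\<phi>. poisson_coeff z (cis \<phi>) n)
    \<in> borel_measurable borel"
  unfolding poisson_coeff_def by measurable

text \<open>The Poisson series is dominated by a summable sequence uniformly in the angle, so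
  termwise integration against an L1 function is justified.\<close>

lemma integral_mehler:
  assumes "integrable M F" "norm z = 1" "norm r < 1"
  shows "integral\<^sup>L M (\<lambda>\<phi>. mehler z (cis \<phi>) r * F \<phi>) = op_series F z r"
proof -
  let ?f = "\<lambda>n \<phi>. poisson_coeff z (cis \<phi>) n * r ^ n * F \<phi>"
  let ?I = "integral\<^sup>L M (\<lambda>\<phi>. norm (F \<phi>))"
  have b: "norm (poisson_coeff z (cis \<phi>) n * r ^ n) \<le> poisson_coeff_bound * ((real n + 1) ^ 2
      * norm r ^ n)" for n \<phi>
  proof -
    have "norm (poisson_coeff z (cis \<phi>) n) * norm r ^ n \<le> poisson_coeff_bound * (real n + 1) ^ 2
        * norm r ^ n"
      using assms by (intro mult_right_mono norm_poisson_coeff_le) auto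
    then show ?thesis by (simp add: norm_mult norm_power mult.assoc)
  qed
  have int: "integrable M (?f n)" for n
    using b by (intro integrable_bounded_mult assms) measurable
  have sm: "summable (\<lambda>n. norm (?f n \<phi>))" for \<phi>
    using summable_mult2[OF summable_poisson_coeff[of z "cis \<phi>" r], of "norm (F \<phi>)"] assms
    by (simp add: norm_mult)
  have "(\<lambda>n. integral\<^sup>L M (?f n)) sums integral\<^sup>L M (\<lambda>\<phi>. \<Sum>n. ?f n \<phi>)"
  proof (rule sums_integral)
    show "summable (\<lambda>n. integral\<^sup>L M (\<lambda>\<phi>. norm (?f n \<phi>)))"
    proof (rule summable_comparison_test')
      show "summable (\<lambda>n. poisson_coeff_bound * ((real n + 1) ^ 2 * norm r ^ n) * ?I)"
        using assms by (intro summable_mult2 summable_mult summable_poly_geometric) auto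
      fix n
      have "integral\<^sup>L M (\<lambda>\<phi>. norm (?f n \<phi>)) \<le> integral\<^sup>L M (\<lambda>\<phi>. poisson_coeff_bound * ((real n
          + 1) ^ 2 * norm r ^ n) * norm (F \<phi>))"
      proof (rule integral_mono)
        show "integrable M (\<lambda>\<phi>. norm (?f n \<phi>))" using int by simp
        show "integrable M (\<lambda>\<phi>. poisson_coeff_bound * ((real n + 1) ^ 2 * norm r ^ n) * norm (F \<phi>))"
          using assms by simp
        fix \<phi>
        show "norm (?f n \<phi>) \<le> poisson_coeff_bound * ((real n + 1) ^ 2 * norm r ^ n) * norm (F \<phi>)"
          unfolding norm_mult[of _ "F \<phi>"] by (intro mult_right_mono b) auto
      qed
      also have "\<dots> = poisson_coeff_bound * ((real n + 1) ^ 2 * norm r ^ n) * ?I" by simp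
      finally show "norm (integral\<^sup>L M (\<lambda>\<phi>. norm (?f n \<phi>))) \<le> poisson_coeff_bound * ((real n
          + 1) ^ 2 * norm r ^ n) * ?I"
        by simp
    qed
  qed (use int sm in auto)
  moreover have "(\<Sum>n. ?f n \<phi>) = mehler z (cis \<phi>) r * F \<phi>" for \<phi>
    unfolding mehler_def
    using assms by (intro suminf_mult2[symmetric] summable_norm_cancel[OF summable_poisson_coeff])
        auto
  moreover have "integral\<^sup>L M (?f n) = qf n * qherm n z * qherm_coeff F n * r ^ n" for n
  proof -
    have "integral\<^sup>L M (?f n) = integral\<^sup>L M (\<lambda>\<phi>. (qf n * qherm n z * r ^ n) * (qherm n (cis \<phi>)
        * F \<phi>))"
      by (intro Bochner_Integration.integral_cong refl) (simp add: poisson_coeff_def mult_ac)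
    then show ?thesis by (simp only: integral_mult_right_zero qherm_coeff_def) (simp only: mult_ac)
  qed
  ultimately show ?thesis unfolding op_series_def by (simp add: sums_iff)
qed

text \<open>By orthogonality only the term m = n survives, and the norm 1/(q;q)_n cancels
  \<open>qf n\<close>. Applying the kernel thus acts diagonally on the coefficients, which is the
  source of the composition law.\<close>

lemma qherm_coeff_weight_op_series:
  assumes "integrable M F" "norm r < 1"
  shows "integrable M (\<lambda>\<phi>. weight \<phi> * op_series F (cis \<phi>) r)"
    and "qherm_coeff (\<lambda>\<phi>. weight \<phi> * op_series F (cis \<phi>) r) n = r ^ n * qherm_coeff F n"
proof -
  let ?I = "integral\<^sup>L M (\<lambda>\<phi>. norm (F \<phi>))"
  have I0: "?I \<ge> 0" by simp
  let ?f = "\<lambda>n m \<phi>. qherm n (cis \<phi>) * weight \<phi> * (qf m * qherm m (cis \<phi>) * qherm_coeff F m * r ^ m)"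
  let ?B = "\<lambda>n m. qherm_bound * (real n + 1) * weight_bound * (poisson_coeff_bound * ?I * ((real m
      + 1) ^ 2 * norm r ^ m))"
  have b: "norm (?f n m \<phi>) \<le> ?B n m" for n m \<phi>
  proof -
    have "norm (qf m * qherm m (cis \<phi>) * qherm_coeff F m * r ^ m)
        \<le> exp (1 / (1 - q)) * (qherm_bound * (real m + 1)) * (qherm_bound * (real m + 1) * ?I)
            * norm r ^ m"
      unfolding norm_mult norm_power using assms qherm_bound_nonneg
      by (intro mult_mono norm_qf_le norm_qherm_le norm_qherm_coeff_le) auto
    also have "\<dots> = poisson_coeff_bound * ?I * ((real m + 1) ^ 2 * norm r ^ m)"
      by (simp add: poisson_coeff_bound_def power2_eq_square mult_ac)
    finally have "norm (qf m * qherm m (cis \<phi>) * qherm_coeff F m * r ^ m) \<le> poisson_coeff_bound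
        * ?I * ((real m + 1) ^ 2 * norm r ^ m)" .
    then show ?thesis
      unfolding norm_mult[of "qherm n (cis \<phi>) * weight \<phi>"] norm_mult[of "qherm n (cis \<phi>)"]
      using qherm_bound_nonneg weight_bound_nonneg by (intro mult_mono norm_qherm_le
          norm_weight_le) auto
  qed
  have int: "integrable M (?f n m)" for n m
    using b by (intro integrable_M_bounded) measurable
  have sB: "summable (?B n)" for n
    using assms by (intro summable_mult summable_poly_geometric) auto
  have sm: "summable (\<lambda>m. norm (?f n m \<phi>))" for n \<phi>
    using b by (intro summable_comparison_test'[OF sB]) auto
  have si: "summable (\<lambda>m. integral\<^sup>L M (\<lambda>\<phi>. norm (?f n m \<phi>)))" for n
  proof (rule summable_comparison_test')
    show "summable (\<lambda>m. ?B n m * measure M (space M))"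
      using sB by (intro summable_mult2)
    fix m
    have "integral\<^sup>L M (\<lambda>\<phi>. norm (?f n m \<phi>)) \<le> integral\<^sup>L M (\<lambda>\<phi>. ?B n m)"
      using int by (intro integral_mono b) (auto intro: finite_measure.integrable_const[OF
          finite_measure_M])
    then show "norm (integral\<^sup>L M (\<lambda>\<phi>. norm (?f n m \<phi>))) \<le> ?B n m * measure M (space M)"
      by (simp add: mult_ac)
  qed
  have sum: "(\<Sum>m. ?f n m \<phi>) = qherm n (cis \<phi>) * weight \<phi> * op_series F (cis \<phi>) r" for n \<phi>
    unfolding op_series_def
    using assms by (intro suminf_mult summable_norm_cancel[OF summable_op_series]) auto
  \<comment> \<open>Since \<open>qherm 0\<close> is 1, the family \<open>?f 0\<close> sums to the
    function itself.\<close>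
  show "integrable M (\<lambda>\<phi>. weight \<phi> * op_series F (cis \<phi>) r)"
    using integrable_suminf[of M "?f 0", OF int AE_I2[OF sm] si] unfolding sum by simp
  have "(\<lambda>m. integral\<^sup>L M (?f n m)) sums integral\<^sup>L M (\<lambda>\<phi>. \<Sum>m. ?f n m \<phi>)"
    using int sm si by (intro sums_integral) auto
  moreover have "integral\<^sup>L M (\<lambda>\<phi>. \<Sum>m. ?f n m \<phi>) = qherm_coeff (\<lambda>\<phi>. weight \<phi>
      * op_series F (cis \<phi>) r) n"
    unfolding sum qherm_coeff_def[of "\<lambda>\<phi>. weight \<phi> * op_series F (cis \<phi>) r"] by (simp only:
        mult.assoc)
  moreover have "integral\<^sup>L M (?f n m) = (if m = n then r ^ n * qherm_coeff F n else 0)" for m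
  proof -
    have "integral\<^sup>L M (?f n m)
      = integral\<^sup>L M (\<lambda>\<phi>. (qf m * qherm_coeff F m * r ^ m) * (qherm n (cis \<phi>) * qherm m (cis \<phi>)
          * weight \<phi>))"
      by (intro Bochner_Integration.integral_cong refl) (simp add: mult_ac)
    also have "\<dots> = (qf m * qherm_coeff F m * r ^ m) * gram n m"
      by (simp add: gram_def)
    finally show ?thesis by (simp add: gram_eq)
  qed
  ultimately have "(\<lambda>m. if m = n then r ^ n * qherm_coeff F n else 0) sums qherm_coeff (\<lambda>\<phi>. weight
      \<phi> * op_series F (cis \<phi>) r) n"
    by simp
  moreover have "(\<lambda>m. if m = n then r ^ n * qherm_coeff F n else 0) sums (r ^ n * qherm_coeff F n)"
    by (rule sums_single)
  ultimately show "qherm_coeff (\<lambda>\<phi>. weight \<phi> * op_series F (cis \<phi>) r) n = r ^ n * qherm_coeff F n"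
    by (rule sums_unique2)
qed

text \<open>The zeros force \<open>cis\<close> into a countable set, and \<open>cis\<close> is
  injective on [0, pi]. Needed because the parameters of \<open>K_h\<close> may put zeros on the
  unit circle.\<close>

lemma AE_qpoch_nonzero: "AE \<phi> in M. qpoch (C * cis \<phi>) q \<noteq> 0 \<and> qpoch (C / cis \<phi>) q \<noteq> 0"
proof -
  have inj: "inj_on cis {0..pi}"
    by (rule inj_onI) (metis atLeastAtMost_iff cis.sel(1) cos_inj_pi)
  have "countable ({0..pi} \<inter> cis -` (\<Union>k. {1 / (C * Q ^ k), C * Q ^ k}))"
  proof (rule countable_image_inj_on)
    show "countable (cis ` ({0..pi} \<inter> cis -` (\<Union>k. {1 / (C * Q ^ k), C * Q ^ k})))"
      by (rule countable_subset[of _ "\<Union>k. {1 / (C * Q ^ k), C * Q ^ k}"]) auto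
    show "inj_on cis ({0..pi} \<inter> cis -` (\<Union>k. {1 / (C * Q ^ k), C * Q ^ k}))"
      by (rule inj_on_subset[OF inj]) auto
  qed
  then have "{0..pi} \<inter> cis -` (\<Union>k. {1 / (C * Q ^ k), C * Q ^ k}) \<in> null_sets lborel"
    by (rule countable_imp_null_set_lborel)
  then have A: "AE \<phi> in lborel. \<phi> \<notin> {0..pi} \<inter> cis -` (\<Union>k. {1 / (C * Q ^ k), C * Q ^ k})"
    by (rule AE_not_in)
  have B: "qpoch (C * cis \<phi>) q \<noteq> 0 \<and> qpoch (C / cis \<phi>) q \<noteq> 0"
    if "cis \<phi> \<notin> (\<Union>k. {1 / (C * Q ^ k), C * Q ^ k})" for \<phi>
  proof -
    have "C * cis \<phi> * Q ^ k \<noteq> 1" for k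
    proof
      assume *: "C * cis \<phi> * Q ^ k = 1"
      then have "C * Q ^ k \<noteq> 0" using Q_nonzero by auto
      with * have "cis \<phi> = 1 / (C * Q ^ k)" by (simp add: field_simps)
      with that show False by auto
    qed
    moreover have "C / cis \<phi> * Q ^ k \<noteq> 1" for k
    proof
      assume "C / cis \<phi> * Q ^ k = 1"
      then have "cis \<phi> = C * Q ^ k" by (simp add: field_simps)
      with that show False by auto
    qed
    ultimately show ?thesis by (simp add: qpoch_nonzero_iff)
  qed
  from A have "AE \<phi> in lborel. \<phi> \<in> {0..pi} \<longrightarrow> qpoch (C * cis \<phi>) q \<noteq> 0 \<and> qpoch (C / cis \<phi>) q \<noteq> 0"
    by eventually_elim (use B in blast)
  then show ?thesis
    unfolding M_def by (subst AE_restrict_space_iff) auto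
qed

section \<open>The operators as power series in q^(a/2)\<close>

definition K_integrand :: "complex \<Rightarrow> (real \<Rightarrow> complex) \<Rightarrow> real \<Rightarrow> complex" where
  "K_integrand c f \<phi> = w_H q (cos \<phi>) * f (cos \<phi>) * of_real (sin \<phi>) / h q (cos \<phi>) [- 1 / c, - c
      * of_real q]"

definition K_factor :: "real \<Rightarrow> complex \<Rightarrow> complex" where
  "K_factor a c = of_real (q powr (a * (a - 3) / 4)) * (of_real (1 - q) / (2 * c)) powr of_real a"

definition K_h :: "real \<Rightarrow> complex \<Rightarrow> real \<Rightarrow> complex" where
  "K_h a c x = h q x [- c * of_real (q powr (1 - a / 2)), - of_real (q powr (a / 2)) / c]"

lemma eit_cos: "0 \<le> \<phi> \<Longrightarrow> \<phi> \<le> pi \<Longrightarrow> eit (cos \<phi>) = cis \<phi>"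
  by (simp add: eit_def arccos_cos cis_conv_exp)

lemma norm_eit: "norm (eit x) = 1"
  by (simp add: eit_def)

lemma h_pair: "h q x [A, B] = (qpoch (A * eit x) q * qpoch (A / eit x) q) * (qpoch (B * eit x) q
    * qpoch (B / eit x) q)"
  by (simp add: h_def qpochs_def)

lemma w_H_sin:
  assumes "0 \<le> \<phi>" "\<phi> \<le> pi"
  shows "w_H q (cos \<phi>) * of_real (sin \<phi>) = weight \<phi>"
proof -
  have s: "sqrt (1 - (cos \<phi>)\<^sup>2) = sin \<phi>"
    using assms sin_ge_zero by (simp add: sin_squared_eq[symmetric])
  have e: "eit (cos \<phi>) ^ 2 = cis (2 * \<phi>)"
    using assms by (simp add: eit_cos power2_eq_square cis_mult)
  show ?thesis
  proof (cases "sin \<phi> = 0")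
    \<comment> \<open>At the end points \<open>w_H\<close> divides by 0 and the left side is 0; the
      right side agrees because \<open>qpoch 1 q\<close> vanishes.\<close>
    case True
    then have "cis (2 * \<phi>) = 1"
      by (simp add: complex_eq_iff cos_double sin_double cos_squared_eq)
    moreover have "qpoch 1 q = 0" using qpoch_nonzero_iff[of 1] by (metis mult_1 power_0)
    ultimately show ?thesis using True by (simp add: weight_def)
  next
    case False
    then show ?thesis
      by (simp add: w_H_def weight_def qpochs_def e s Q_def[symmetric] mult_ac)
  qed
qed

lemma q_powr_less_1: "a > 0 \<Longrightarrow> q powr a < 1"
  using q_pos q_less_1 by (simp add: powr_def mult_pos_neg)

text \<open>\<open>K_integrand\<close> collects what depends on neither a nor x; the rest of the
  integrand is the product side of \<open>mehler_formula\<close> with r = q^(a/2).\<close>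

lemma K_eq_op_series:
  assumes "a > 0" "integrable M (K_integrand c f)"
  shows "K q a c f x = K_factor a c * K_h a c x * op_series (K_integrand c f) (eit x) (of_real (q
      powr (a / 2)))"
proof -
  let ?r = "of_real (q powr (a / 2)) :: complex" and ?z = "eit x"
  have r: "norm ?r < 1" using q_powr_less_1[of "a / 2"] assms by simp
  have r2: "?r\<^sup>2 = of_real (q powr a)"
    using q_pos by (simp add: power2_eq_square flip: of_real_mult powr_add)
  have "(LINT \<phi>:{0..pi}|lborel.
             w_H q (cos \<phi>) * qpoch (of_real (q powr a)) q * f (cos \<phi>) * of_real (sin \<phi>)
             / (h q (cos \<phi>) [?r * ?z, ?r / ?z] * h q (cos \<phi>) [- 1 / c, - c * of_real q]))
    = (LINT \<phi>:{0..pi}|lborel. mehler ?z (cis \<phi>) ?r * K_integrand c f \<phi>)"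
  proof (rule set_lebesgue_integral_cong)
    show "\<forall>\<phi>. \<phi> \<in> {0..pi} \<longrightarrow>
             w_H q (cos \<phi>) * qpoch (of_real (q powr a)) q * f (cos \<phi>) * of_real (sin \<phi>)
             / (h q (cos \<phi>) [?r * ?z, ?r / ?z] * h q (cos \<phi>) [- 1 / c, - c * of_real q])
       = mehler ?z (cis \<phi>) ?r * K_integrand c f \<phi>"
    proof (intro allI impI)
      fix \<phi> assume \<phi>: "\<phi> \<in> {0..pi}"
      have H: "h q (cos \<phi>) [?r * ?z, ?r / ?z]
        = qpoch (?r * ?z * cis \<phi>) q * qpoch (?r * ?z / cis \<phi>) q * qpoch (?r * cis \<phi> / ?z) q
            * qpoch (?r / (?z * cis \<phi>)) q"
        using \<phi> by (simp add: h_pair eit_cos mult_ac)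
      \<comment> \<open>If k = 0, both sides are 0 by the convention for division by zero, so the
        rewriting holds at every angle.\<close>
      have "H \<noteq> 0 \<Longrightarrow> H * m = p \<Longrightarrow> w * p * g * s / (H * k) = m * (w * g * s / k)"
        for H m p w g s k :: complex
        by (cases "k = 0") (auto simp: field_simps)
      moreover have "h q (cos \<phi>) [?r * ?z, ?r / ?z] \<noteq> 0"
        unfolding H mult_eq_0_iff de_Morgan_disj using r
        by (intro conjI qpoch_nonzero) (simp_all add: norm_mult norm_divide norm_eit)
      moreover have "h q (cos \<phi>) [?r * ?z, ?r / ?z] * mehler ?z (cis \<phi>) ?r
          = qpoch (of_real (q powr a)) q"
        unfolding H r2[symmetric] by (intro mehler_formula r norm_eit) simp
      ultimately show "w_H q (cos \<phi>) * qpoch (of_real (q powr a)) q * f (cos \<phi>) * of_real (sin \<phi>)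
             / (h q (cos \<phi>) [?r * ?z, ?r / ?z] * h q (cos \<phi>) [- 1 / c, - c * of_real q])
       = mehler ?z (cis \<phi>) ?r * K_integrand c f \<phi>"
        unfolding K_integrand_def by blast
    qed
  qed simp
  also have "\<dots> = op_series (K_integrand c f) ?z ?r"
    using integral_mehler[OF assms(2) norm_eit r] by (simp add: integral_M)
  finally show ?thesis
    unfolding K_def K_factor_def K_h_def using assms(1) by simp
qed

section \<open>Composition of two operators\<close>

lemma qherm_coeff_cong_AE:
  assumes "integrable M G" "integrable M G'" "AE \<phi> in M. G \<phi> = G' \<phi>"
  shows "qherm_coeff G = qherm_coeff G'"
proof
  fix n
  show "qherm_coeff G n = qherm_coeff G' n"
    unfolding qherm_coeff_def using assms(3)
    by (intro integral_cong_AE borel_measurable_integrable integrable_qherm_mult assms) auto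
qed

text \<open>The outer factor \<open>K_h\<close> of the first operator cancels the denominator of the
  second, leaving the weight times the series. The first conclusion says that the image lies in the
  domain of the second operator.\<close>

lemma K_integrand_K:
  fixes a :: real and c :: complex
  assumes "a > 0" "c \<noteq> 0" "integrable M (K_integrand c f)"
  defines "c' \<equiv> c * of_real (q powr (- a / 2))"
  shows "integrable M (K_integrand c' (K q a c f))"
    and "qherm_coeff (K_integrand c' (K q a c f)) n
       = K_factor a c * of_real (q powr (a / 2)) ^ n * qherm_coeff (K_integrand c f) n"
proof -
  let ?F = "K_integrand c f" and ?G = "K_integrand c' (K q a c f)" and ?r
      = "of_real (q powr (a / 2)) :: complex"
  let ?G' = "\<lambda>\<phi>. K_factor a c * (weight \<phi> * op_series ?F (cis \<phi>) ?r)"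
  have r: "norm ?r < 1" using q_powr_less_1[of "a / 2"] assms by simp
  \<comment> \<open>This is where q^(-a/2) is forced: the two denominator parameters for
    \<open>c'\<close> are exactly the two parameters of \<open>K_h a c\<close>, in exchanged
    order.\<close>
  have c1: "- 1 / c' = - of_real (q powr (a / 2)) / c"
    using q_pos by (simp add: c'_def powr_minus field_simps)
  have "q powr (1 - a / 2) = q powr (- a / 2) * q"
    using q_pos powr_add[of q "- a / 2" 1] by simp
  then have c2: "- c' * of_real q = - c * of_real (q powr (1 - a / 2))"
    by (simp add: c'_def)
  have hh: "h q x [- 1 / c', - c' * of_real q] = K_h a c x" for x
    unfolding c1 c2 K_h_def h_pair by (rule mult.commute)
  have eq: "?G \<phi> = ?G' \<phi>" if "\<phi> \<in> {0..pi}" "K_h a c (cos \<phi>) \<noteq> 0" for \<phi>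
  proof -
    have "?G \<phi> = (w_H q (cos \<phi>) * of_real (sin \<phi>)) * (K q a c f (cos \<phi>) / K_h a c (cos \<phi>))"
      unfolding K_integrand_def hh by simp
    also have "K q a c f (cos \<phi>) / K_h a c (cos \<phi>) = K_factor a c * op_series ?F (cis \<phi>) ?r"
      using that by (simp add: K_eq_op_series[OF assms(1,3)] eit_cos)
    finally show ?thesis using that by (simp add: w_H_sin)
  qed
  have nz: "AE \<phi> in M. K_h a c (cos \<phi>) \<noteq> 0"
    using AE_qpoch_nonzero[of "- c * of_real (q powr (1 - a / 2))"]
      AE_qpoch_nonzero[of "- of_real (q powr (a / 2)) / c"] AE_space[of M]
    by eventually_elim (simp add: K_h_def h_pair eit_cos)
  have AE: "AE \<phi> in M. ?G \<phi> = ?G' \<phi>"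
    using nz AE_space[of M] by eventually_elim (rule eq, auto)
  have i': "integrable M ?G'"
    by (intro integrable_mult_right qherm_coeff_weight_op_series assms r)
  have kh: "(\<lambda>\<phi>. K_h a c (cos \<phi>)) \<in> borel_measurable M"
  proof -
    define A where "A = - c * of_real (q powr (1 - a / 2))"
    define B where "B = - of_real (q powr (a / 2)) / c"
    have eq: "K_h a c (cos \<phi>) = (qpoch (A * cis \<phi>) q * qpoch (A / cis \<phi>) q) * (qpoch (B * cis \<phi>) q
        * qpoch (B / cis \<phi>) q)"
      if "\<phi> \<in> space M" for \<phi>
      using that unfolding K_h_def h_pair A_def[symmetric] B_def[symmetric] by (simp add: eit_cos)
    have "(\<lambda>\<phi>. (qpoch (A * cis \<phi>) q * qpoch (A / cis \<phi>) q) * (qpoch (B * cis \<phi>) q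
        * qpoch (B / cis \<phi>) q))
        \<in> borel_measurable M"
      by (rule measurable_M) measurable
    then show ?thesis by (subst measurable_cong[OF eq])
  qed
  \<comment> \<open>Measurability needs a formula valid everywhere: at zeros of \<open>K_h\<close>
    the quotient is 0 by the convention for division by zero.\<close>
  have G_eq: "?G \<phi> = (if K_h a c (cos \<phi>) = 0 then 0 else ?G' \<phi>)" if "\<phi> \<in> space M" for \<phi>
  proof (cases "K_h a c (cos \<phi>) = 0")
    case True
    then show ?thesis unfolding K_integrand_def hh by simp
  qed (use eq[of \<phi>] that in auto)
  have "(\<lambda>\<phi>. if K_h a c (cos \<phi>) = 0 then 0 else ?G' \<phi>) \<in> borel_measurable M"
    using kh borel_measurable_integrable[OF i'] by measurable
  then have "?G \<in> borel_measurable M"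
    by (rule measurable_cong[THEN iffD1, rotated]) (simp only: G_eq)
  with i' AE show "integrable M ?G"
    by (subst integrable_cong_AE[where g = ?G']) (auto dest: borel_measurable_integrable)
  from qherm_coeff_cong_AE[OF this i' AE]
  have "qherm_coeff ?G n = qherm_coeff ?G' n" by simp
  also have "\<dots> = K_factor a c * qherm_coeff (\<lambda>\<phi>. weight \<phi> * op_series ?F (cis \<phi>) ?r) n"
    unfolding qherm_coeff_def by (simp only: mult.left_commute[of "qherm _ _" "K_factor a c"]
        integral_mult_right_zero)
  also have "\<dots> = K_factor a c * ?r ^ n * qherm_coeff ?F n"
    using qherm_coeff_weight_op_series(2)[OF assms(3) r] by simp
  finally show "qherm_coeff ?G n = K_factor a c * ?r ^ n * qherm_coeff ?F n" .
qed

text \<open>A positive real factor leaves the argument unchanged, so the principal branch is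
  multiplicative here even for complex c.\<close>

lemma powr_of_real_mult:
  fixes w s :: complex
  assumes "r > 0" "w \<noteq> 0"
  shows "(of_real r * w) powr s = of_real r powr s * w powr s"
  using assms by (simp add: powr_def Ln_times_of_real Ln_of_real distrib_left exp_add)

text \<open>The quadratic exponent produces a cross term a b / 2 under addition, and the power of q
  contributed by the shifted parameter supplies exactly that.\<close>

lemma K_factor_add:
  assumes "c \<noteq> 0"
  shows "K_factor b (c * of_real (q powr (- a / 2))) * K_factor a c = K_factor (a + b) c"
proof -
  let ?w = "of_real (1 - q) / (2 * c)"
  have w: "?w \<noteq> 0" using assms q_less_1 by simp
  have "of_real (1 - q) / (2 * (c * of_real (q powr (- a / 2)))) = of_real (q powr (a / 2)) * ?w"
    using q_pos by (simp add: powr_minus field_simps)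
  then have "(of_real (1 - q) / (2 * (c * of_real (q powr (- a / 2))))) powr of_real b
     = (of_real (q powr (a / 2)) * ?w) powr of_real b"
    by (simp only:)
  also have "\<dots> = of_real (q powr (a / 2)) powr of_real b * ?w powr of_real b"
    using w q_pos by (intro powr_of_real_mult) auto
  also have "of_real (q powr (a / 2)) powr of_real b = (of_real (q powr (a * b / 2)) :: complex)"
    using q_pos by (simp add: powr_of_real powr_powr)
  finally have 1: "(of_real (1 - q) / (2 * (c * of_real (q powr (- a / 2))))) powr of_real b
     = of_real (q powr (a * b / 2)) * ?w powr of_real b" .
  have "q powr (b * (b - 3) / 4) * q powr (a * b / 2) * q powr (a * (a - 3) / 4)
      = q powr ((a + b) * (a + b - 3) / 4)"
    unfolding powr_add[symmetric] by (intro arg_cong[of _ _ "\<lambda>x. q powr x"]) (simp add: field_simps)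
  then have 2: "of_real (q powr (b * (b - 3) / 4)) * of_real (q powr (a * b / 2))
      * of_real (q powr (a * (a - 3) / 4))
      = (of_real (q powr ((a + b) * (a + b - 3) / 4)) :: complex)"
    by (simp only: of_real_mult[symmetric])
  have 3: "?w powr of_real b * ?w powr of_real a = ?w powr of_real (a + b)"
    using w by (simp add: powr_add mult.commute)
  show ?thesis
    unfolding K_factor_def 1 2[symmetric] 3[symmetric] by (simp only: mult_ac)
qed

text \<open>The first operator multiplies the n-th coefficient by q^(a n/2); evaluating the second
  series at q^(b/2) combines this to q^((a+b)n/2). The factors \<open>K_factor\<close> and
  \<open>K_h\<close> combine likewise.\<close>

lemma K_semigroup:
  assumes "a > 0" "b > 0" "c \<noteq> 0" "integrable M (K_integrand c f)"
  shows "K q b (c * of_real (q powr (- a / 2))) (K q a c f) x = K q (a + b) c f x"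
proof -
  let ?c' = "c * of_real (q powr (- a / 2))" and ?F = "K_integrand c f"
  have r: "of_real (q powr (a / 2)) * of_real (q powr (b / 2)) = (of_real (q powr ((a
      + b) / 2)) :: complex)"
    by (simp add: add_divide_distrib powr_add)
  have rab: "norm (of_real (q powr ((a + b) / 2)) :: complex) < 1"
    using q_powr_less_1[of "(a + b) / 2"] assms by simp
  have "op_series (K_integrand ?c' (K q a c f)) (eit x) (of_real (q powr (b / 2)))
     = (\<Sum>n. K_factor a c * (qf n * qherm n (eit x) * qherm_coeff ?F n * of_real (q powr ((a
         + b) / 2)) ^ n))"
    unfolding op_series_def K_integrand_K(2)[OF assms(1,3,4)] r[symmetric]
    by (simp add: power_mult_distrib mult_ac)
  also have "\<dots> = K_factor a c * op_series ?F (eit x) (of_real (q powr ((a + b) / 2)))"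
    unfolding op_series_def
    by (intro suminf_mult summable_norm_cancel[OF summable_op_series] assms norm_eit rab)
  finally have S: "op_series (K_integrand ?c' (K q a c f)) (eit x) (of_real (q powr (b / 2)))
     = K_factor a c * op_series ?F (eit x) (of_real (q powr ((a + b) / 2)))" .
  have "q powr (- a / 2) * q powr (1 - b / 2) = q powr (1 - (a + b) / 2)"
    unfolding powr_add[symmetric] by (intro arg_cong[of _ _ "\<lambda>x. q powr x"]) (simp add: field_simps)
  then have H1: "- ?c' * of_real (q powr (1 - b / 2)) = - c * of_real (q powr (1 - (a + b) / 2))"
    by (simp add: mult.assoc flip: of_real_mult)
  have "q powr (b / 2) / q powr (- a / 2) = q powr ((a + b) / 2)"
    unfolding powr_diff[symmetric] by (intro arg_cong[of _ _ "\<lambda>x. q powr x"]) (simp add: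
        field_simps)
  then have H2: "- of_real (q powr (b / 2)) / ?c' = - of_real (q powr ((a + b) / 2)) / c"
    by (metis divide_divide_eq_left minus_divide_left mult.commute of_real_divide)
  have H: "K_h b ?c' x = K_h (a + b) c x"
    unfolding K_h_def H1 H2 ..
  have "K q b ?c' (K q a c f) x = K_factor b ?c' * K_factor a c * K_h (a + b) c x
      * op_series ?F (eit x) (of_real (q powr ((a + b) / 2)))"
    unfolding K_eq_op_series[OF assms(2) K_integrand_K(1)[OF assms(1,3,4)]] S H by (simp only:
        mult_ac)
  also have "\<dots> = K q (a + b) c f x"
    using K_eq_op_series[OF _ assms(4), of "a + b"] assms(1,2) unfolding K_factor_add[OF assms(3)]
        by simp
  finally show ?thesis .
qed

section \<open>Differentiability in the order a\<close>

lemma field_differentiable_compose':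
  "f field_differentiable at z \<Longrightarrow> g field_differentiable at (f z)
      \<Longrightarrow> (\<lambda>x. g (f x)) field_differentiable at z"
  for f g :: "complex \<Rightarrow> complex"
  using field_differentiable_compose[of f z g] by (simp add: o_def)

text \<open>The operator value extends to complex orders as a product of compositions of
  differentiable functions. Positivity of a places q^(a/2) inside the unit disc, where the series is
  differentiable.\<close>

lemma K_difference_quotient:
  assumes "a > 0" "c \<noteq> 0" "integrable M (K_integrand c f)"
  shows "\<exists>L. ((\<lambda>\<delta>. (K q (a + \<delta>) c f x - K q a c f x) / of_real \<delta>) \<longlongrightarrow> L) (at_right 0)"
proof -
  let ?F = "K_integrand c f" and ?z = "eit x" and ?w = "of_real (1 - q) / (2 * c)"
  define E where "E t = exp (of_real (ln q) * t)" for t :: complex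
  define u where "u t = - c * E (1 - t / 2)" for t
  define v where "v t = - E (t / 2) / c" for t
  \<comment> \<open>The extension of \<open>K q t c f x\<close> to complex t, with \<open>E\<close>
    in the role of the power q^t.\<close>
  define k where "k t = E (t * (t - 3) / 4) * ?w powr t
    * ((qpoch (u t * ?z) q * qpoch (u t / ?z) q) * (qpoch (v t * ?z) q * qpoch (v t / ?z) q))
    * op_series ?F ?z (E (t / 2))" for t
  have E: "E (of_real s) = of_real (q powr s)" for s :: real
    using q_pos by (simp add: E_def powr_def mult.commute flip: exp_of_real)
  have Ed: "E field_differentiable at t" for t
    unfolding E_def by (auto intro!: derivative_eq_intros simp: field_differentiable_def)
  have K: "K q t c f x = k (of_real t)" if "t > 0" for t
  proof -
    have e: "of_real t * (of_real t - 3) / 4 = (of_real (t * (t - 3) / 4) :: complex)"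
      "1 - of_real (t / 2) = (of_real (1 - t / 2) :: complex)" "of_real t / 2
          = (of_real (t / 2) :: complex)"
      by simp_all
    show ?thesis
      unfolding K_eq_op_series[OF that assms(3)] K_factor_def K_h_def h_pair k_def u_def v_def e E
      by simp
  qed
  have ra: "norm (E (of_real a / 2)) < 1"
    using q_powr_less_1[of "a / 2"] assms(1) E[of "a / 2"] by simp
  have w0: "?w \<noteq> 0" using assms q_less_1 by simp
  have lin: "(\<lambda>t. t / 2) field_differentiable at t" "(\<lambda>t. 1 - t / 2) field_differentiable at t"
    "(\<lambda>t. t * (t - 3) / 4) field_differentiable at t" for t :: complex
    unfolding field_differentiable_def by (auto intro!: derivative_eq_intros)
  note Elin = field_differentiable_compose'[OF lin(1) Ed] field_differentiable_compose'[OF lin(2)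
      Ed]
    field_differentiable_compose'[OF lin(3) Ed]
  have ud: "u field_differentiable at t" for t
    unfolding u_def by (intro field_differentiable_mult field_differentiable_const Elin)
  have "v = (\<lambda>t. - 1 / c * E (t / 2))" by (simp add: v_def fun_eq_iff)
  then have vd: "v field_differentiable at t" for t
    by (simp only:) (intro field_differentiable_mult field_differentiable_const Elin)
  have wd: "(\<lambda>t. ?w powr t) field_differentiable at t" for t
    unfolding powr_def using w0 by (auto intro!: derivative_eq_intros simp:
        field_differentiable_def)
  have qd: "(\<lambda>t. qpoch (g t * ?z) q * qpoch (g t / ?z) q) field_differentiable at t"
    if "g field_differentiable at t" for g t
    unfolding divide_inverse
    by (intro field_differentiable_mult field_differentiable_const qpoch_field_differentiable that
        field_differentiable_compose'[where g = "\<lambda>A. qpoch A q"])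
  have sd: "(\<lambda>t. op_series ?F ?z (E (t / 2))) field_differentiable at (of_real a)"
    by (rule field_differentiable_compose'[OF Elin(1) op_series_field_differentiable[OF assms(3)
        norm_eit ra]])
  have "k field_differentiable at (of_real a)"
    unfolding k_def
    by (rule field_differentiable_mult[OF field_differentiable_mult[OF
          field_differentiable_mult[OF Elin(3) wd] field_differentiable_mult[OF qd[OF ud] qd[OF
              vd]]] sd])
  then obtain D where "(k has_field_derivative D) (at (of_real a))"
    by (auto simp: field_differentiable_def)
  then have "((\<lambda>s. (k (of_real a + s) - k (of_real a)) / s) \<longlongrightarrow> D) (at 0)"
    by (simp add: DERIV_def)
  \<comment> \<open>Restricts the complex derivative to positive real increments.\<close>
  moreover have "filterlim (of_real :: real \<Rightarrow> complex) (at 0) (at_right 0)"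
  proof (rule filterlim_atI)
    show "(of_real \<longlongrightarrow> (0 :: complex)) (at_right 0)"
      by (rule tendsto_eq_intros) (auto intro!: tendsto_eq_intros)
    show "\<forall>\<^sub>F \<delta> in at_right 0. of_real \<delta> \<noteq> (0 :: complex)"
      by (auto simp: eventually_at_filter)
  qed
  ultimately have "((\<lambda>\<delta>. (k (of_real a + of_real \<delta>) - k (of_real a)) / of_real \<delta>) \<longlongrightarrow> D) (at_right 0)"
    by (rule filterlim_compose)
  moreover have "\<forall>\<^sub>F \<delta> in at_right 0. (k (of_real a + of_real \<delta>) - k (of_real a)) / of_real \<delta>
     = (K q (a + \<delta>) c f x - K q a c f x) / of_real \<delta>"
    using eventually_at_right_less[of "0 :: real"]
    by eventually_elim (use assms in \<open>simp add: K\<close>)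
  ultimately show ?thesis by (blast intro: Lim_transform_eventually)
qed

end

theorem theorem4p4:
  fixes q a :: real and c :: complex and f :: "real \<Rightarrow> complex"
  assumes "0 < q" and "q < 1" and "0 < a" and "c \<noteq> 0" and "f \<in> K_dom q c"
  shows "\<forall>x\<in>{-1..1}.
           J_t_exists q a c f x \<and>
           J_t_exists q 0 (c * of_real (q powr (- a / 2))) (K q a c f) x \<and>
           J_t q a c f x = (J_t q 0 (c * of_real (q powr (- a / 2))) \<circ> K q a c) f x"
proof
  fix x :: real
  interpret q_base q using assms by unfold_locales
  let ?c' = "c * of_real (q powr (- a / 2))"
  have F: "integrable M (K_integrand c f)"
    using assms(5) by (simp add: K_dom_def integrable_M K_integrand_def[abs_def])
  obtain L where L: "(J_quot q a c f x \<longlongrightarrow> L) (at_right 0)"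
    using K_difference_quotient[OF assms(3,4) F, of x] unfolding J_quot_def[abs_def] by blast
  \<comment> \<open>Only positive increments are compared, as the composition law requires b > 0;
    the value at order 0 is the identity by definition. The limit \<open>L\<close> obtained at order
    a thereby also serves at order 0.\<close>
  have "\<forall>\<^sub>F \<delta> in at_right 0. J_quot q a c f x \<delta> = J_quot q 0 ?c' (K q a c f) x \<delta>"
    using eventually_at_right_less[of "0 :: real"]
  proof eventually_elim
    case (elim \<delta>)
    have "K q 0 ?c' (K q a c f) x = K q a c f x" by (simp add: K_def)
    then show ?case
      using K_semigroup[OF assms(3) elim assms(4) F, of x] by (simp add: J_quot_def)
  qed
  with L have L': "(J_quot q 0 ?c' (K q a c f) x \<longlongrightarrow> L) (at_right 0)"
    by (rule Lim_transform_eventually)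
  show "J_t_exists q a c f x \<and> J_t_exists q 0 ?c' (K q a c f) x \<and>
      J_t q a c f x = (J_t q 0 ?c' \<circ> K q a c) f x"
    using L L' tendsto_Lim[OF trivial_limit_at_right_real L] tendsto_Lim[OF trivial_limit_at_right_real L']
    by (auto simp: J_t_exists_def J_t_def)
qed

end
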